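(* Let $t, k, g$ be integers such that $t, g > k \geq 2$. Then there is a (large enough) integer $q$ and a set $\Pi = \{\pi_1, \pi_2, \ldots, \pi_t\}$ of $t$ permutations in $S_{m_q}$, where $m_q = (k-1)^q (t-1)^{q-1}$, such that the graph $G(t,k,q,\Pi)$ has no cycles of length $h$ for any $k < h < g$.
   Context: All graphs are finite and simple; $[m]=\{1,\dots,m\}$ and $S_m$ is the group of all permutations of $[m]$. For graphs $G,H$ and $S\subseteq V(G)$, $G\vee_S H$ denotes the graph obtained from a copy of $G$ and $|S|$ disjoint copies $H_v$ ($v\in S$) of $H$ by joining each vertex $v\in S$ to every vertex of $H_v$. Construction of $G(t,k,q,\Pi)$, for integers $t,k,q\ge 2$, $m_i=(k-1)^i(t-1)^{i-1}$ ($i\ge1$), and $\Pi=\{\pi_1,\dots,\pi_t\}\subseteq S_{m_q}$: (i) Let $G_1\cong K_k$, let $x\in V(G_1)$ be a vertex called the root, and let $W_1=V(G_1)\setminus\{x\}$, whose vertices are labelled $\binom{1}{\ell}$, $\ell\in[k-1]$. (ii) Recursively for $i\ge2$, let $G_i=G_{i-1}\vee_{W_{i-1}}(t-1)K_{k-1}$, where $(t-1)K_{k-1}$ is the disjoint union of $t-1$ copies of $K_{k-1}$, and $V(G_i)=V(G_{i-1})\cup W_i$, where $W_i$ is the set of new vertices. The vertices of $W_i$ are labelled by $2\times i$ matrices $\binom{u\; u_i}{v\; v_i}$ with $\binom{u}{v}\in W_{i-1}$, $u_i\in[t-1]$, $v_i\in[k-1]$, this label representing the $v_i$-th vertex in the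 $u_i$-th copy of $K_{k-1}$ attached to the vertex $\binom{u}{v}$. The set $W_i$ (level $i$) is linearly ordered lexicographically by columns, i.e. by the sequence $(u_1,v_1,u_2,v_2,\dots,u_i,v_i)$. One has $|W_i|=m_i$. (iii) Take $t$ disjoint copies $G_q^1,\dots,G_q^t$ of $G_q$ with roots $x_1,\dots,x_t$ and level-$q$ vertex sets $W_q^1,\dots,W_q^t$. Let $\varphi_j:W_q^j\to[m_q]$ be the order-preserving bijection. (iv) Identify all roots $x_1,\dots,x_t$ to a single vertex. (v) For every $j\in[m_q]$, identify the $t$ vertices $\varphi_i^{-1}(\pi_i(j))$, $1\le i\le t$, to a single vertex. The resulting graph is $G(t,k,q,\Pi)$. *)

theory Defs
  imports "Graph_Theory.Graph_Theory"
begin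

text \<open>
  Finite simple graphs are the loop-free symmetric digraphs of the locale
  \<^locale>\<open>pair_graph\<close>: an edge is represented by its two opposite arcs.
\<close>

definition complete_graph_on :: "'a set \<Rightarrow> 'a pair_pre_digraph" where
  "complete_graph_on A = \<lparr> pverts = A, parcs = {(x, y). x \<in> A \<and> y \<in> A \<and> x \<noteq> y} \<rparr>"

definition disjoint_copies :: "nat \<Rightarrow> 'a pair_pre_digraph \<Rightarrow> (nat \<times> 'a) pair_pre_digraph" where
  "disjoint_copies n H =
     \<lparr> pverts = {1..n} \<times> pverts H,
       parcs = {((i, x), (i, y)) | i x y. i \<in> {1..n} \<and> (x, y) \<in> parcs H} \<rparr>"

text \<open>
  The graph \<open>G \<or>\<^sub>S H\<close>. The vertex \<open>y\<close> of the copy of \<open>H\<close> attached to \<open>v \<in> S\<close> is named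
  \<open>c v y\<close>; the naming function \<open>c\<close> has to be injective on pairs and to avoid the vertices of \<open>G\<close>.
\<close>

definition attach_copies ::
  "('a \<Rightarrow> 'b \<Rightarrow> 'a) \<Rightarrow> 'a pair_pre_digraph \<Rightarrow> 'a set \<Rightarrow> 'b pair_pre_digraph \<Rightarrow> 'a pair_pre_digraph" where
  "attach_copies c G S H =
     \<lparr> pverts = pverts G \<union> {c v y | v y. v \<in> S \<and> y \<in> pverts H},
       parcs = parcs G
         \<union> {(c v y, c v z) | v y z. v \<in> S \<and> (y, z) \<in> parcs H}
         \<union> {(v, c v y) | v y. v \<in> S \<and> y \<in> pverts H}
         \<union> {(c v y, v) | v y. v \<in> S \<and> y \<in> pverts H} \<rparr>"

text \<open>
  A vertex is the list of columns \<open>(u\<^sub>1, v\<^sub>1), (u\<^sub>2, v\<^sub>2), \<dots>\<close> of its label, with \<open>u\<^sub>1 = 1\<close>; the root is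
  the empty list. So level \<open>0\<close> consists of the root alone.
\<close>

type_synonym label = "(nat \<times> nat) list"

abbreviation (input) root :: label where
  "root \<equiv> []"

fun level :: "nat \<Rightarrow> nat \<Rightarrow> nat \<Rightarrow> label set" where
  "level t k 0 = {root}"
| "level t k (Suc 0) = {[(1, l)] | l. l \<in> {1..k-1}}"
| "level t k (Suc (Suc i)) =
     {w @ [(u, v)] | w u v. w \<in> level t k (Suc i) \<and> u \<in> {1..t-1} \<and> v \<in> {1..k-1}}"

text \<open>The value at \<open>0\<close> is a convention and plays no role.\<close>

fun clique_tree :: "nat \<Rightarrow> nat \<Rightarrow> nat \<Rightarrow> label pair_pre_digraph" where
  "clique_tree t k 0 = complete_graph_on {root}"
| "clique_tree t k (Suc 0) = complete_graph_on (insert root (level t k 1))"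
| "clique_tree t k (Suc (Suc i)) =
     attach_copies (\<lambda>w col. w @ [col]) (clique_tree t k (Suc i)) (level t k (Suc i))
       (disjoint_copies (t-1) (complete_graph_on {1..k-1}))"

definition level_size :: "nat \<Rightarrow> nat \<Rightarrow> nat \<Rightarrow> nat" where
  "level_size t k i = (k-1)^i * (t-1)^(i-1)"

definition label_less :: "(label \<times> label) set" where
  "label_less = lexord (less_than <*lex*> less_than)"

text \<open>
  The order-preserving bijection from level \<open>q\<close> onto \<open>{1..level_size t k q}\<close>, given as the rank
  function; see \<open>bij_betw_level_pos\<close> and \<open>level_pos_less_iff\<close> below.
\<close>

definition level_pos :: "nat \<Rightarrow> nat \<Rightarrow> nat \<Rightarrow> label \<Rightarrow> nat" where
  "level_pos t k q w = card {w' \<in> level t k q. w' = w \<or> (w', w) \<in> label_less}"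

text \<open>
  The quotient by an equivalence relation on the vertices. Parallel edges are merged; loops do not
  arise in the instance used here (\<open>pair_graph_glued_graph\<close>).
\<close>

definition identify_vertices :: "('a \<times> 'a) set \<Rightarrow> 'a pair_pre_digraph \<Rightarrow> 'a set pair_pre_digraph" where
  "identify_vertices r G =
     \<lparr> pverts = pverts G // r,
       parcs = {(r `` {x}, r `` {y}) | x y. (x, y) \<in> parcs G} \<rparr>"

definition glue_rel ::
  "nat \<Rightarrow> nat \<Rightarrow> nat \<Rightarrow> (nat \<Rightarrow> nat \<Rightarrow> nat) \<Rightarrow> ((nat \<times> label) \<times> (nat \<times> label)) set" where
  "glue_rel t k q \<pi> =
     (let \<phi>_inv = inv_into (level t k q) (level_pos t k q) in
      Id_on (pverts (disjoint_copies t (clique_tree t k q)))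
      \<union> {((i, root), (i', root)) | i i'. i \<in> {1..t} \<and> i' \<in> {1..t}}
      \<union> {((i, \<phi>_inv (\<pi> i j)), (i', \<phi>_inv (\<pi> i' j))) | i i' j.
            i \<in> {1..t} \<and> i' \<in> {1..t} \<and> j \<in> {1..level_size t k q}})"

text \<open>The graph \<open>G(t,k,q,\<Pi>)\<close> for \<open>\<Pi> = {\<pi> 1, \<dots>, \<pi> t}\<close>.\<close>

definition glued_graph ::
  "nat \<Rightarrow> nat \<Rightarrow> nat \<Rightarrow> (nat \<Rightarrow> nat \<Rightarrow> nat) \<Rightarrow> (nat \<times> label) set pair_pre_digraph" where
  "glued_graph t k q \<pi> =
     identify_vertices (glue_rel t k q \<pi>) (disjoint_copies t (clique_tree t k q))"

text \<open>
  For \<open>h \<ge> 3\<close> these are the usual undirected cycles; for \<open>h = 2\<close> the library notion also counts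
  the closed walk along an edge and back.
\<close>

definition has_cycle_of_length :: "'a pair_pre_digraph \<Rightarrow> nat \<Rightarrow> bool" where
  "has_cycle_of_length G h \<longleftrightarrow> (\<exists>p. pre_digraph.cycle (with_proj G) p \<and> length p = h)"


subsection \<open>The construction is well-defined\<close>

lemma length_level: "w \<in> level t k i \<Longrightarrow> length w = i"
  by (induction t k i arbitrary: w rule: level.induct) auto

lemma level_step:
  "level t k (Suc (Suc i)) =
     (\<lambda>(w, c). w @ [c]) ` (level t k (Suc i) \<times> ({1..t-1} \<times> {1..k-1}))"
  by (force simp: image_iff)

lemma finite_level: "finite (level t k i)"
proof (induction t k i rule: level.induct)
  case (3 t k i)
  then show ?case unfolding level_step by blast
qed auto

lemma card_level:
  assumes "i \<ge> 1"
  shows "card (level t k i) = level_size t k i"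
  using assms
proof (induction t k i rule: level.induct)
  case (2 t k)
  have "level t k (Suc 0) = (\<lambda>l. [(1, l)]) ` {1..k-1}" by auto
  moreover have "inj_on (\<lambda>l. [(1::nat, l)]) {1..k-1}" by (auto simp: inj_on_def)
  ultimately have "card (level t k (Suc 0)) = card {1..k-1}" by (metis card_image)
  then show ?case by (simp add: level_size_def)
next
  case (3 t k i)
  have "inj_on (\<lambda>(w, c). w @ [c]) (level t k (Suc i) \<times> ({1..t-1} \<times> {1..k-1}))"
    by (auto simp: inj_on_def)
  then have "card (level t k (Suc (Suc i))) = level_size t k (Suc i) * ((t-1) * (k-1))"
    unfolding level_step using 3 by (simp add: card_image card_cartesian_product)
  then show ?case by (simp add: level_size_def)
qed simp

lemma label_less_irrefl: "(w, w) \<notin> label_less"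
  unfolding label_less_def by (rule lexord_irreflexive) auto

lemma label_less_trans:
  "(w, w') \<in> label_less \<Longrightarrow> (w', w'') \<in> label_less \<Longrightarrow> (w, w'') \<in> label_less"
  unfolding label_less_def by (rule lexord_trans) auto

lemma label_less_linear: "(w, w') \<in> label_less \<or> w = w' \<or> (w', w) \<in> label_less"
  unfolding label_less_def by (rule lexord_linear) auto

lemma level_pos_less:
  assumes "w' \<in> level t k q" "(w, w') \<in> label_less"
  shows "level_pos t k q w < level_pos t k q w'"
  unfolding level_pos_def
proof (rule psubset_card_mono)
  show "finite {w'' \<in> level t k q. w'' = w' \<or> (w'', w') \<in> label_less}"
    using finite_level by auto
  show "{w'' \<in> level t k q. w'' = w \<or> (w'', w) \<in> label_less}
      \<subset> {w'' \<in> level t k q. w'' = w' \<or> (w'', w') \<in> label_less}"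
  proof (rule psubsetI)
    show "{w'' \<in> level t k q. w'' = w \<or> (w'', w) \<in> label_less}
        \<subseteq> {w'' \<in> level t k q. w'' = w' \<or> (w'', w') \<in> label_less}"
      using assms(2) by (auto intro: label_less_trans)
    have "w' \<notin> {w'' \<in> level t k q. w'' = w \<or> (w'', w) \<in> label_less}"
      using assms(2) label_less_irrefl label_less_trans by auto
    with assms(1) show "{w'' \<in> level t k q. w'' = w \<or> (w'', w) \<in> label_less}
        \<noteq> {w'' \<in> level t k q. w'' = w' \<or> (w'', w') \<in> label_less}"
      by blast
  qed
qed

lemma level_pos_less_iff:
  assumes "w \<in> level t k q" "w' \<in> level t k q"
  shows "level_pos t k q w < level_pos t k q w' \<longleftrightarrow> (w, w') \<in> label_less"
  using level_pos_less[OF assms(1), of w'] level_pos_less[OF assms(2), of w]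
    label_less_linear[of w w'] by fastforce

lemma bij_betw_level_pos:
  assumes "q \<ge> 1"
  shows "bij_betw (level_pos t k q) (level t k q) {1..level_size t k q}"
proof -
  have inj: "inj_on (level_pos t k q) (level t k q)"
  proof (rule inj_onI)
    fix w w' assume "w \<in> level t k q" "w' \<in> level t k q" "level_pos t k q w = level_pos t k q w'"
    then show "w = w'"
      using level_pos_less[of w t k q w'] level_pos_less[of w' t k q w]
        label_less_linear[of w w'] by fastforce
  qed
  have "level_pos t k q w \<in> {1..level_size t k q}" if "w \<in> level t k q" for w
  proof -
    have "level_pos t k q w \<le> card (level t k q)"
      unfolding level_pos_def by (rule card_mono) (auto simp: finite_level)
    moreover have "card {w} \<le> level_pos t k q w"
      unfolding level_pos_def by (rule card_mono) (use that finite_level in auto)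
    ultimately show ?thesis using card_level assms by auto
  qed
  then have "level_pos t k q ` level t k q \<subseteq> {1..level_size t k q}" by blast
  then have "level_pos t k q ` level t k q = {1..level_size t k q}"
    using inj assms by (intro card_subset_eq) (auto simp: card_image card_level)
  with inj show ?thesis by (simp add: bij_betw_def)
qed

lemma level_subset_clique_tree: "i \<ge> 1 \<Longrightarrow> level t k i \<subseteq> pverts (clique_tree t k i)"
  by (induction t k i rule: level.induct)
     (auto simp: attach_copies_def disjoint_copies_def complete_graph_on_def)

lemma pverts_clique_tree: "pverts (clique_tree t k i) = (\<Union>j\<le>i. level t k j)"
proof (induction t k i rule: clique_tree.induct)
  case (2 t k)
  have "{..Suc 0} = {0, Suc 0}" by auto
  then show ?case by (auto simp: complete_graph_on_def)
next
  case (3 t k i)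
  have "pverts (clique_tree t k (Suc (Suc i))) =
      pverts (clique_tree t k (Suc i)) \<union> level t k (Suc (Suc i))"
    by (force simp: attach_copies_def disjoint_copies_def complete_graph_on_def)
  then show ?case using 3 by (auto simp: atMost_Suc)
qed (auto simp: complete_graph_on_def)

lemma finite_clique_tree: "finite (pverts (clique_tree t k i))"
  by (simp add: pverts_clique_tree finite_level)

lemma clique_tree_arcs:
  "(x, y) \<in> parcs (clique_tree t k i) \<Longrightarrow>
     x \<in> pverts (clique_tree t k i) \<and> y \<in> pverts (clique_tree t k i) \<and> x \<noteq> y
     \<and> (y, x) \<in> parcs (clique_tree t k i)"
proof (induction t k i arbitrary: x y rule: clique_tree.induct)
  case (3 t k i)
  have "level t k (Suc i) \<subseteq> pverts (clique_tree t k (Suc i))"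
    by (rule level_subset_clique_tree) simp
  with 3 show ?case
    by (simp add: attach_copies_def disjoint_copies_def complete_graph_on_def) blast
qed (auto simp: complete_graph_on_def)

lemma pair_graph_clique_tree: "pair_graph (clique_tree t k i)"
proof -
  have "parcs (clique_tree t k i) \<subseteq> pverts (clique_tree t k i) \<times> pverts (clique_tree t k i)"
    using clique_tree_arcs by auto
  then have "finite (parcs (clique_tree t k i))"
    by (rule finite_subset) (simp add: finite_clique_tree)
  then show ?thesis
    by unfold_locales
       (use clique_tree_arcs in \<open>auto simp: finite_clique_tree symmetric_def intro!: symI\<close>)
qed

context
  fixes t k q :: nat and \<pi> :: "nat \<Rightarrow> nat \<Rightarrow> nat"
  assumes q: "q \<ge> 1" and perm: "\<And>i. i \<in> {1..t} \<Longrightarrow> \<pi> i permutes {1..level_size t k q}"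
begin

lemma glue_rel_iff:
  "((i, x), (i', x')) \<in> glue_rel t k q \<pi> \<longleftrightarrow>
     i \<in> {1..t} \<and> i' \<in> {1..t} \<and>
     (i = i' \<and> x = x' \<and> x \<in> pverts (clique_tree t k q)
      \<or> x = root \<and> x' = root
      \<or> x \<in> level t k q \<and> x' \<in> level t k q
        \<and> (\<exists>j\<in>{1..level_size t k q}. level_pos t k q x = \<pi> i j \<and> level_pos t k q x' = \<pi> i' j))"
proof -
  let ?inv = "inv_into (level t k q) (level_pos t k q)"
  note bij = bij_betw_level_pos[OF q, of t k]
  have *: "y = ?inv (\<pi> l j) \<longleftrightarrow> y \<in> level t k q \<and> level_pos t k q y = \<pi> l j"
    if "l \<in> {1..t}" "j \<in> {1..level_size t k q}" for y l j
  proof -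
    have "\<pi> l j \<in> {1..level_size t k q}"
      using permutes_in_image[OF perm[OF that(1)]] that(2) by blast
    then show ?thesis
      using bij by (metis bij_betw_def f_inv_into_f inv_into_f_f inv_into_into)
  qed
  have "((i, x), (i', x')) \<in> glue_rel t k q \<pi> \<longleftrightarrow>
      i \<in> {1..t} \<and> i = i' \<and> x = x' \<and> x \<in> pverts (clique_tree t k q)
      \<or> i \<in> {1..t} \<and> i' \<in> {1..t} \<and> x = root \<and> x' = root
      \<or> (\<exists>j. i \<in> {1..t} \<and> i' \<in> {1..t} \<and> j \<in> {1..level_size t k q}
            \<and> x = ?inv (\<pi> i j) \<and> x' = ?inv (\<pi> i' j))"
    unfolding glue_rel_def Let_def disjoint_copies_def Un_iff Id_on_iff mem_Collect_eq
      prod.inject by (simp only: pair_pre_digraph.select_convs mem_Times_iff fst_conv snd_conv) blast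
  moreover have "(\<exists>j. i \<in> {1..t} \<and> i' \<in> {1..t} \<and> j \<in> {1..level_size t k q}
            \<and> x = ?inv (\<pi> i j) \<and> x' = ?inv (\<pi> i' j))
      \<longleftrightarrow> (\<exists>j. i \<in> {1..t} \<and> i' \<in> {1..t} \<and> j \<in> {1..level_size t k q}
            \<and> (x \<in> level t k q \<and> level_pos t k q x = \<pi> i j)
            \<and> (x' \<in> level t k q \<and> level_pos t k q x' = \<pi> i' j))"
    by (intro ex_cong1 conj_cong refl *)
  ultimately show ?thesis by blast
qed

lemma root_mem: "root \<in> pverts (clique_tree t k q)"
  unfolding pverts_clique_tree by (rule UN_I[of 0]) auto

lemma equiv_glue_rel: "equiv (pverts (disjoint_copies t (clique_tree t k q))) (glue_rel t k q \<pi>)"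
proof (rule equivI)
  have root: "root \<notin> level t k q" using length_level q by fastforce
  have level: "level t k q \<subseteq> pverts (clique_tree t k q)"
    using level_subset_clique_tree q by blast
  show "glue_rel t k q \<pi> \<subseteq> pverts (disjoint_copies t (clique_tree t k q))
      \<times> pverts (disjoint_copies t (clique_tree t k q))"
    using level root_mem by (fastforce simp: glue_rel_iff disjoint_copies_def)
  show "refl_on (pverts (disjoint_copies t (clique_tree t k q))) (glue_rel t k q \<pi>)"
    by (auto simp: refl_on_def glue_rel_iff disjoint_copies_def)
  show "sym (glue_rel t k q \<pi>)"
    unfolding sym_def by (auto simp: glue_rel_iff)
  show "trans (glue_rel t k q \<pi>)"
  proof (rule transI)
    fix a b c assume *: "(a, b) \<in> glue_rel t k q \<pi>" "(b, c) \<in> glue_rel t k q \<pi>"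
    obtain i x where a: "a = (i, x)" by force
    obtain i' x' where b: "b = (i', x')" by force
    obtain i'' x'' where c: "c = (i'', x'')" by force
    have inj: "j = j'" if "\<pi> i' j = \<pi> i' j'" "i' \<in> {1..t}" for j j'
      using injD[OF permutes_inj[OF perm[OF that(2)]] that(1)] .
    have ab: "((i, x), (i', x')) \<in> glue_rel t k q \<pi>"
      and bc: "((i', x'), (i'', x'')) \<in> glue_rel t k q \<pi>"
      using * a b c by auto
    note ab' = ab[unfolded glue_rel_iff] and bc' = bc[unfolded glue_rel_iff]
    consider "i = i'" "x = x'" | "i' = i''" "x' = x''" | "x = root" "x' = root" "x'' = root"
      | "x \<in> level t k q" "x' \<in> level t k q" "x'' \<in> level t k q"
        "\<exists>j\<in>{1..level_size t k q}. level_pos t k q x = \<pi> i j \<and> level_pos t k q x' = \<pi> i' j"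
        "\<exists>j\<in>{1..level_size t k q}. level_pos t k q x' = \<pi> i' j \<and> level_pos t k q x'' = \<pi> i'' j"
      using ab' bc' root by blast
    then show "(a, c) \<in> glue_rel t k q \<pi>"
    proof cases
      case 4
      from 4(4) obtain j where j: "j \<in> {1..level_size t k q}"
        "level_pos t k q x = \<pi> i j" "level_pos t k q x' = \<pi> i' j" by blast
      from 4(5) obtain j' where j': "level_pos t k q x' = \<pi> i' j'" "level_pos t k q x'' = \<pi> i'' j'"
        by blast
      have "j = j'" using inj j(3) j'(1) ab' by metis
      then show ?thesis unfolding a c glue_rel_iff using 4 j j' ab' bc' by blast
    qed (use ab bc a c ab' bc' in \<open>auto simp: glue_rel_iff\<close>)
  qed
qed

lemma glue_rel_same_copy: "((i, x), (i, y)) \<in> glue_rel t k q \<pi> \<Longrightarrow> x = y"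
  using bij_betw_level_pos[OF q, of t k] by (auto simp: glue_rel_iff bij_betw_def inj_on_def)

lemma pair_graph_glued_graph: "pair_graph (glued_graph t k q \<pi>)"
proof -
  let ?G = "disjoint_copies t (clique_tree t k q)" and ?r = "glue_rel t k q \<pi>"
  have fin: "finite (pverts ?G)" by (simp add: disjoint_copies_def finite_clique_tree)
  have arc: "x \<in> pverts ?G \<and> y \<in> pverts ?G \<and> (x, y) \<notin> ?r \<and> (y, x) \<in> parcs ?G"
    if "(x, y) \<in> parcs ?G" for x y
    using that by (auto simp: disjoint_copies_def dest: clique_tree_arcs glue_rel_same_copy)
  have arc': "A \<in> pverts (glued_graph t k q \<pi>) \<and> B \<in> pverts (glued_graph t k q \<pi>) \<and> A \<noteq> B
      \<and> (B, A) \<in> parcs (glued_graph t k q \<pi>)"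
    if "(A, B) \<in> parcs (glued_graph t k q \<pi>)" for A B
  proof -
    from that obtain x y where xy: "A = ?r `` {x}" "B = ?r `` {y}" "(x, y) \<in> parcs ?G"
      by (auto simp: glued_graph_def identify_vertices_def)
    note arc_xy = arc[OF xy(3)]
    have "A \<in> pverts ?G // ?r" "B \<in> pverts ?G // ?r"
      unfolding xy(1,2) using arc_xy by (blast intro: quotientI)+
    moreover have "A \<noteq> B"
      unfolding xy(1,2) using arc_xy eq_equiv_class_iff[OF equiv_glue_rel, of x y] by blast
    moreover have "(B, A) \<in> parcs (identify_vertices ?r ?G)"
      unfolding identify_vertices_def xy(1,2) pair_pre_digraph.select_convs using arc_xy by blast
    ultimately show ?thesis
      by (simp add: glued_graph_def identify_vertices_def)
  qed
  have finv: "finite (pverts (glued_graph t k q \<pi>))"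
    unfolding glued_graph_def identify_vertices_def quotient_def using fin by auto
  have "parcs (glued_graph t k q \<pi>)
      \<subseteq> pverts (glued_graph t k q \<pi>) \<times> pverts (glued_graph t k q \<pi>)"
    using arc' by auto
  then have "finite (parcs (glued_graph t k q \<pi>))"
    by (rule finite_subset) (simp add: finv)
  then show ?thesis
    by unfold_locales (use arc' finv in \<open>auto simp: symmetric_def intro!: symI\<close>)
qed

end

end

theory Submission
  imports Defs
begin

text \<open>
  Let \<open>d = (t-1)(k-1)\<close>. In the copy \<open>i\<close> of the tree, a walk of length less than \<open>g\<close> between two leaves
  only visits levels above \<open>q - g\<close>, so its ends share the prefix of length \<open>q - g\<close>: they are equivalent
  under an equivalence relation \<open>R i\<close> on the glued leaves, all of whose classes have \<open>d\<^sup>g\<close> elements. A cycle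
  that is not contained in one copy thus yields a closed walk of the same length or shorter along the
  relations \<open>R i\<close>, whose consecutive steps use different relations. A cycle inside one copy lies in
  a clique \<open>K\<^sub>k\<close>.

  It remains to find \<open>t\<close> equivalence relations with classes of size \<open>d\<^sup>g\<close> and without such closed
  walks of length less than \<open>g\<close>. Starting from arbitrary ones, one repeatedly passes to the homology
  cover modulo \<open>d\<close>, which raises the girth. It multiplies the number of points by a power
  of \<open>d\<close>, and \<open>m\<^sub>q\<close> is \<open>k - 1\<close> times a power of \<open>d\<close>; hence the points can be identified with the leaves
  for a suitable \<open>q\<close>, and these identifications are the permutations.
\<close>

section \<open>Systems of equivalence relations without short reduced closed walks\<close>

text \<open>Only \<open>x 0\<close>, ..., \<open>x n\<close> and \<open>c 0\<close>, ...,
  \<open>c (n - 1)\<close> matter. In a closed walk the colours \<open>c 0\<close> and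
  \<open>c (n - 1)\<close> may agree; thus every piece of a reduced walk is reduced, and a girth
  bound \<open>g\<close> separates any two points fewer than \<open>g\<close> steps apart.\<close>

definition reduced_walk ::
  "nat set \<Rightarrow> (nat \<Rightarrow> ('a \<times> 'a) set) \<Rightarrow> nat \<Rightarrow> (nat \<Rightarrow> 'a) \<Rightarrow> (nat \<Rightarrow> nat) \<Rightarrow> bool" where
  "reduced_walk I R n x c \<longleftrightarrow>
     (\<forall>j<n. c j \<in> I \<and> (x j, x (Suc j)) \<in> R (c j) \<and> x j \<noteq> x (Suc j))
     \<and> (\<forall>j. Suc j < n \<longrightarrow> c j \<noteq> c (Suc j))"

definition girth_at_least :: "nat set \<Rightarrow> (nat \<Rightarrow> ('a \<times> 'a) set) \<Rightarrow> nat \<Rightarrow> bool" where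
  "girth_at_least I R g \<longleftrightarrow>
     (\<forall>n x c. 1 \<le> n \<and> n < g \<and> reduced_walk I R n x c \<longrightarrow> x 0 \<noteq> x n)"

definition uniform_system ::
  "nat set \<Rightarrow> 'a set \<Rightarrow> (nat \<Rightarrow> ('a \<times> 'a) set) \<Rightarrow> nat \<Rightarrow> bool" where
  "uniform_system I X R s \<longleftrightarrow>
     finite X \<and> (\<forall>i\<in>I. equiv X (R i) \<and> (\<forall>x\<in>X. card (R i `` {x}) = s))"

lemma girth_at_leastD:
  "girth_at_least I R g \<Longrightarrow> reduced_walk I R n x c \<Longrightarrow> 1 \<le> n \<Longrightarrow> n < g \<Longrightarrow> x 0 \<noteq> x n"
  unfolding girth_at_least_def by blast

lemma reduced_walk_subwalk:
  assumes "reduced_walk I R n x c" "i + m \<le> n"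
  shows "reduced_walk I R m (\<lambda>j. x (i + j)) (\<lambda>j. c (i + j))"
  using assms unfolding reduced_walk_def by simp

lemma reduced_walk_extend:
  assumes "reduced_walk I R n x c" "\<gamma> \<in> I" "(x n, y) \<in> R \<gamma>" "x n \<noteq> y"
    and "\<And>m. n = Suc m \<Longrightarrow> c m \<noteq> \<gamma>"
  shows "reduced_walk I R (Suc n) (x(Suc n := y)) (c(n := \<gamma>))"
  proof -
  have "c j \<noteq> \<gamma>" if "Suc j = n" for j using assms(5) that by blast
  with assms(1-4) show ?thesis unfolding reduced_walk_def by (simp add: less_Suc_eq)
qed

lemma reduced_walk_map:
  assumes "reduced_walk I R n x c"
    and "\<And>i u v. i \<in> I \<Longrightarrow> (u, v) \<in> R i \<Longrightarrow> u \<noteq> v \<Longrightarrow> (f u, f v) \<in> S i \<and> f u \<noteq> f v"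
  shows "reduced_walk I S n (f \<circ> x) c"
  using assms(1) assms(2) unfolding reduced_walk_def comp_def by blast

text \<open>The image of a reduced walk is reduced with the same colours, and a closed walk stays
  closed. This serves the projection of the cover, enumerations by \<open>nat\<close> and the
  renumbering of the glued leaves.\<close>

lemma girth_at_least_map:
  assumes "girth_at_least I S g"
    and "\<And>i u v. i \<in> I \<Longrightarrow> (u, v) \<in> R i \<Longrightarrow> u \<noteq> v \<Longrightarrow> (f u, f v) \<in> S i \<and> f u \<noteq> f v"
  shows "girth_at_least I R g"
  unfolding girth_at_least_def
proof (intro allI impI, elim conjE)
  fix n x c
  assume n: "1 \<le> n" "n < g" and walk: "reduced_walk I R n x c"
  have "reduced_walk I S n (f \<circ> x) c"
    by (rule reduced_walk_map[OF walk assms(2)])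
  with assms(1) n have "(f \<circ> x) 0 \<noteq> (f \<circ> x) n"
    unfolding girth_at_least_def by blast
  then show "x 0 \<noteq> x n" by auto
qed

text \<open>Going from \<open>u\<close> to \<open>v\<close> by \<open>R i\<close> and back by
  \<open>R i'\<close> would be a closed walk of length 2. This later tells the permutations
  apart.\<close>

lemma girth_common_pair:
  assumes "girth_at_least I R g" "2 < g" "i \<in> I" "i' \<in> I" "i \<noteq> i'" "(u, v) \<in> R i" "(v, u) \<in> R i'"
  shows "u = v"
proof (rule ccontr)
  assume "u \<noteq> v"
  let ?x = "\<lambda>j::nat. if j = 1 then v else u" and ?c = "\<lambda>j::nat. if j = 0 then i else i'"
  have "reduced_walk I R 2 ?x ?c"
    unfolding reduced_walk_def using assms \<open>u \<noteq> v\<close> by (auto simp: less_2_cases_iff)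
  from girth_at_leastD[OF assms(1) this] assms(2) have "?x 0 \<noteq> ?x 2" by simp
  then show False by simp
qed

text \<open>A cover has points of a new type; pulling back along an enumeration returns to
  \<open>nat\<close>, so that covers can be iterated by induction.\<close>

lemma uniform_system_transfer:
  assumes sys: "uniform_system I X R s" and bij: "bij_betw f Y X"
  shows "uniform_system I Y (\<lambda>i. {(u, v). u \<in> Y \<and> v \<in> Y \<and> (f u, f v) \<in> R i}) s"
  unfolding uniform_system_def
proof (intro conjI ballI)
  show "finite Y" using sys bij_betw_finite[OF bij] by (simp add: uniform_system_def)
  fix i assume i: "i \<in> I"
  let ?S = "{(u, v). u \<in> Y \<and> v \<in> Y \<and> (f u, f v) \<in> R i}"
  have eq: "equiv X (R i)" using sys i by (simp add: uniform_system_def)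
  have fX: "f u \<in> X" if "u \<in> Y" for u using bij that by (auto simp: bij_betw_def)
  show "equiv Y ?S"
  proof (rule equivI)
    show "refl_on Y ?S" using eq fX by (auto simp: refl_on_def equiv_def)
    show "sym ?S" using eq by (auto simp: sym_def equiv_def)
    show "trans ?S" using eq by (auto simp: trans_def equiv_def)
  qed auto
  fix u assume u: "u \<in> Y"
  have "f ` (?S `` {u}) = R i `` {f u}"
  proof (intro set_eqI iffI)
    fix z assume "z \<in> R i `` {f u}"
    then have "z \<in> X" "(f u, z) \<in> R i" using eq by (auto simp: equiv_def)
    then show "z \<in> f ` (?S `` {u})" using bij u by (auto simp: bij_betw_def image_iff)
  qed auto
  moreover have "inj_on f (?S `` {u})"
    by (rule inj_on_subset[OF bij_betw_imp_inj_on[OF bij]]) auto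
  ultimately have "card (?S `` {u}) = card (R i `` {f u})" using card_image by fastforce
  then show "card (?S `` {u}) = s" using sys i fX[OF u] by (simp add: uniform_system_def)
qed

section \<open>Homology covers modulo \<open>d\<close>\<close>

definition shift :: "nat \<Rightarrow> 'e \<Rightarrow> ('e \<Rightarrow> nat) \<Rightarrow> ('e \<Rightarrow> nat)" where
  "shift d e a = a(e := (a e + 1) mod d)"

lemma shift_bij:
  assumes "finite E" "e \<in> E"
  shows "bij_betw (shift d e) (E \<rightarrow>\<^sub>E {..<d}) (E \<rightarrow>\<^sub>E {..<d})"
proof -
  have inj: "inj_on (shift d e) (E \<rightarrow>\<^sub>E {..<d})"
  proof (rule inj_onI)
    fix a b assume a: "a \<in> E \<rightarrow>\<^sub>E {..<d}" and b: "b \<in> E \<rightarrow>\<^sub>E {..<d}"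
      and eq: "shift d e a = shift d e b"
    have lt: "a e < d" "b e < d" using a b assms(2) by auto
    have "(a e + 1) mod d = (b e + 1) mod d" using fun_cong[OF eq, of e] by (simp add: shift_def)
    with lt have "a e = b e" by (auto simp: mod_Suc split: if_splits)
    moreover have "a e' = b e'" if "e' \<noteq> e" for e'
      using fun_cong[OF eq, of e'] that by (simp add: shift_def)
    ultimately have "a e' = b e'" for e' by (cases "e' = e") auto
    then show "a = b" by blast
  qed
  moreover have "shift d e ` (E \<rightarrow>\<^sub>E {..<d}) \<subseteq> E \<rightarrow>\<^sub>E {..<d}"
  proof (rule image_subsetI)
    fix a assume a: "a \<in> E \<rightarrow>\<^sub>E {..<d}"
    then have "a e < d" using assms(2) by auto
    then have "(a e + 1) mod d < d" by (intro mod_less_divisor) auto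
    then show "shift d e a \<in> E \<rightarrow>\<^sub>E {..<d}"
      using a assms(2) unfolding shift_def by (auto simp: PiE_iff extensional_def)
  qed
  moreover have "finite (E \<rightarrow>\<^sub>E {..<d})" using assms(1) by (simp add: finite_PiE)
  ultimately show ?thesis
    by (simp add: bij_betw_def endo_inj_surj)
qed

text \<open>
  The homology cover with coefficients in \<open>\<int>/d\<close> of the incidence graph between points and classes:
  every incidence \<open>(x, i)\<close>, of the point \<open>x\<close> with its class under \<open>R i\<close>, carries a counter.
\<close>

definition cover_rel ::
  "nat \<Rightarrow> nat set \<Rightarrow> 'a set \<Rightarrow> (nat \<Rightarrow> ('a \<times> 'a) set) \<Rightarrow> nat
    \<Rightarrow> (('a \<times> ('a \<times> nat \<Rightarrow> nat)) \<times> ('a \<times> ('a \<times> nat \<Rightarrow> nat))) set" where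
  "cover_rel d I X R i = {((x, a), (y, b)). (x, y) \<in> R i
      \<and> a \<in> X \<times> I \<rightarrow>\<^sub>E {..<d} \<and> b \<in> X \<times> I \<rightarrow>\<^sub>E {..<d} \<and> shift d (x, i) a = shift d (y, i) b}"

text \<open>Each \<open>shift d (y, i)\<close> permutes the counters, so over a given
  \<open>(x, a)\<close> every \<open>y\<close> in the class of \<open>x\<close> has exactly one
  lift. Hence \<open>fst\<close> maps each class of the cover bijectively onto a class
  below.\<close>

lemma uniform_system_cover:
  assumes sys: "uniform_system I X R s" and "finite I"
  shows "uniform_system I (X \<times> (X \<times> I \<rightarrow>\<^sub>E {..<d})) (cover_rel d I X R) s"
  unfolding uniform_system_def
proof (intro conjI ballI)
  have fin: "finite (X \<times> I)" using assms by (simp add: uniform_system_def)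
  then show "finite (X \<times> (X \<times> I \<rightarrow>\<^sub>E {..<d}))"
    using sys by (simp add: finite_PiE uniform_system_def)
  fix i assume i: "i \<in> I"
  have eq: "equiv X (R i)" using sys i by (simp add: uniform_system_def)
  have RX: "x \<in> X" "y \<in> X" if "(x, y) \<in> R i" for x y
    using that eq by (auto simp: equiv_def)
  have bij: "bij_betw (shift d (x, i)) (X \<times> I \<rightarrow>\<^sub>E {..<d}) (X \<times> I \<rightarrow>\<^sub>E {..<d})" if "x \<in> X" for x
    using that i by (intro shift_bij[OF fin]) auto
  show "equiv (X \<times> (X \<times> I \<rightarrow>\<^sub>E {..<d})) (cover_rel d I X R i)"
  proof (rule equivI)
    show "cover_rel d I X R i
        \<subseteq> (X \<times> (X \<times> I \<rightarrow>\<^sub>E {..<d})) \<times> (X \<times> (X \<times> I \<rightarrow>\<^sub>E {..<d}))"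
      using RX by (auto simp: cover_rel_def)
    show "refl_on (X \<times> (X \<times> I \<rightarrow>\<^sub>E {..<d})) (cover_rel d I X R i)"
      using eq by (auto simp: refl_on_def equiv_def cover_rel_def)
    show "sym (cover_rel d I X R i)"
      using eq by (auto simp: sym_def equiv_def cover_rel_def)
    have "trans (R i)" using eq by (simp add: equiv_def)
    then show "trans (cover_rel d I X R i)"
      by (intro transI) (auto simp: cover_rel_def dest: transD)
  qed
  fix z assume "z \<in> X \<times> (X \<times> I \<rightarrow>\<^sub>E {..<d})"
  then obtain x a where z: "z = (x, a)" "x \<in> X" "a \<in> X \<times> I \<rightarrow>\<^sub>E {..<d}" by blast
  let ?C = "cover_rel d I X R i `` {z}"
  have "fst ` ?C = R i `` {x}"
  proof (intro set_eqI iffI)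
    fix y assume "y \<in> R i `` {x}"
    then have y: "(x, y) \<in> R i" by simp
    have "shift d (x, i) a \<in> X \<times> I \<rightarrow>\<^sub>E {..<d}" using bij_betw_apply[OF bij] z by blast
    then have "shift d (x, i) a \<in> shift d (y, i) ` (X \<times> I \<rightarrow>\<^sub>E {..<d})"
      using bij_betw_imp_surj_on[OF bij[OF RX(2)[OF y]]] by simp
    then obtain b where "b \<in> X \<times> I \<rightarrow>\<^sub>E {..<d}" "shift d (y, i) b = shift d (x, i) a"
      by (elim imageE) simp
    then have "(y, b) \<in> ?C" using y z by (simp add: cover_rel_def)
    then show "y \<in> fst ` ?C" by force
  qed (auto simp: cover_rel_def z)
  moreover have "inj_on fst ?C"
  proof (rule inj_onI)
    fix p p' assume "p \<in> ?C" "p' \<in> ?C" "fst p = fst p'"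
    then obtain y b b' where "p = (y, b)" "p' = (y, b')" "y \<in> X"
      "b \<in> X \<times> I \<rightarrow>\<^sub>E {..<d}" "b' \<in> X \<times> I \<rightarrow>\<^sub>E {..<d}" "shift d (y, i) b = shift d (y, i) b'"
      using RX by (cases p; cases p') (auto simp: cover_rel_def z)
    then show "p = p'" using bij_betw_imp_inj_on[OF bij[of y]] by (auto dest: inj_onD)
  qed
  ultimately have "card ?C = card (R i `` {x})" using card_image by fastforce
  then show "card ?C = s" using sys i z by (simp add: uniform_system_def)
qed

text \<open>
  A closed walk of length \<open>g\<close> in the cover would return every counter to its initial value. But the
  first step changes the counter of \<open>(x\<^sub>1, c\<^sub>0)\<close>, and no later step does, as the walk below cannot
  come back to \<open>x\<^sub>1\<close> in fewer than \<open>g\<close> steps.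
\<close>

lemma girth_cover:
  assumes sys: "uniform_system I X R s" and "finite I" and "d \<ge> 2" and girth: "girth_at_least I R g"
  shows "girth_at_least I (cover_rel d I X R) (Suc g)"
proof -
  have fin: "finite (X \<times> I)" using assms by (simp add: uniform_system_def)
  have proj: "(fst u, fst v) \<in> R i \<and> fst u \<noteq> fst v"
    if "i \<in> I" "(u, v) \<in> cover_rel d I X R i" "u \<noteq> v" for i u v
  proof -
    obtain x a y b where uv: "u = (x, a)" "v = (y, b)" by (metis surj_pair)
    have *: "(x, y) \<in> R i" "a \<in> X \<times> I \<rightarrow>\<^sub>E {..<d}" "b \<in> X \<times> I \<rightarrow>\<^sub>E {..<d}"
      "shift d (x, i) a = shift d (y, i) b"
      using that(2) by (auto simp: cover_rel_def uv)
    have "x \<in> X" using sys that(1) *(1) by (auto simp: uniform_system_def equiv_def)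
    then have "inj_on (shift d (x, i)) (X \<times> I \<rightarrow>\<^sub>E {..<d})"
      using bij_betw_imp_inj_on[OF shift_bij[OF fin]] that(1) by blast
    then have "x \<noteq> y" using * uv that(3) by (auto dest: inj_onD)
    with * show ?thesis by (simp add: uv)
  qed
  have short: "girth_at_least I (cover_rel d I X R) g"
    by (rule girth_at_least_map[OF girth]) (rule proj)
  show ?thesis
    unfolding girth_at_least_def
  proof (intro allI impI, elim conjE)
    fix n z c assume n: "1 \<le> n" "n < Suc g" and walk: "reduced_walk I (cover_rel d I X R) n z c"
    show "z 0 \<noteq> z n"
    \<comment> \<open>Shorter walks are handled by projection, a single step by the definition of a
      walk. What remains is \<open>n = g\<close> with \<open>n \<ge> 2\<close>.\<close>
    proof (cases "n < g \<or> n = 1")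
      case True
      then show ?thesis using short walk n by (auto simp: girth_at_least_def reduced_walk_def)
    next
      case False
      with n have n: "n = g" "2 \<le> n" by auto
      define x where "x j = fst (z j)" for j
      define a where "a j = snd (z j)" for j
      have "reduced_walk I R n (fst \<circ> z) c"
        by (rule reduced_walk_map[OF walk]) (rule proj)
      moreover have "fst \<circ> z = x" by (auto simp: x_def)
      ultimately have wx: "reduced_walk I R n x c" by simp
      \<comment> \<open>The projected walk may close up, but its proper pieces are shorter than
        \<open>g\<close>.\<close>
      have apart: "x i \<noteq> x j" if "i < j" "j \<le> n" "j - i < n" for i j
      proof -
        have "reduced_walk I R (j - i) (\<lambda>m. x (i + m)) (\<lambda>m. c (i + m))"
          using reduced_walk_subwalk[OF wx] that by simp
        moreover have "1 \<le> j - i" "j - i < g" using that n(1) by auto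
        ultimately have "x (i + 0) \<noteq> x (i + (j - i))"
          using girth unfolding girth_at_least_def by blast
        then show ?thesis using that(1) by simp
      qed
      have step: "shift d (x j, c j) (a j) = shift d (x (Suc j), c j) (a (Suc j))
          \<and> a j \<in> X \<times> I \<rightarrow>\<^sub>E {..<d} \<and> c j \<in> I \<and> x j \<in> X \<and> x (Suc j) \<in> X" if "j < n" for j
      proof -
        have "c j \<in> I" "(z j, z (Suc j)) \<in> cover_rel d I X R (c j)"
          using walk that by (auto simp: reduced_walk_def)
        moreover have "(x j, x (Suc j)) \<in> R (c j)" using wx that by (auto simp: reduced_walk_def)
        ultimately show ?thesis using sys
          by (auto simp: cover_rel_def x_def a_def uniform_system_def equiv_def split_beta)
      qed
      let ?e = "(x 1, c 0)"
      have "a (Suc j) ?e = a 1 ?e" if "j < n" for j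
        using that
      proof (induction j)
        case (Suc j)
        have "x (Suc (Suc j)) \<noteq> x 1" using apart[of 1 "Suc (Suc j)"] Suc.prems by auto
        \<comment> \<open>For \<open>j = 0\<close> the step starts at \<open>x 1\<close> itself;
          there \<open>c 0 \<noteq> c 1\<close> protects the counter.\<close>
        moreover have "x (Suc j) \<noteq> x 1 \<or> c (Suc j) \<noteq> c 0"
        proof (cases j)
          case 0
          then show ?thesis using walk Suc.prems unfolding reduced_walk_def by metis
        next
          case (Suc j')
          then show ?thesis using apart[of 1 "Suc j"] Suc.prems by auto
        qed
        moreover have "shift d (x (Suc j), c (Suc j)) (a (Suc j)) ?e
            = shift d (x (Suc (Suc j)), c (Suc j)) (a (Suc (Suc j))) ?e"
          using step[of "Suc j"] Suc.prems by simp
        ultimately have "a (Suc (Suc j)) ?e = a (Suc j) ?e" by (auto simp: shift_def)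
        then show ?case using Suc by simp
      qed simp
      from this[of "n - 1"] have "a n ?e = a 1 ?e" using n by simp
      \<comment> \<open>At \<open>?e\<close> the shift on the side of \<open>x 0\<close> has no
        effect, the one on the side of \<open>x 1\<close> adds 1.\<close>
      moreover have "a 0 ?e = (a 1 ?e + 1) mod d"
      proof -
        have "x 0 \<noteq> x 1" using apart[of 0 1] n by simp
        moreover have "shift d (x 0, c 0) (a 0) ?e = shift d (x 1, c 0) (a 1) ?e"
          using step[of 0] n by simp
        ultimately show ?thesis by (auto simp: shift_def)
      qed
      moreover have "a 1 ?e < d"
      proof -
        have "?e \<in> X \<times> I" "a 1 \<in> X \<times> I \<rightarrow>\<^sub>E {..<d}" using step[of 0] step[of 1] n by auto
        then show ?thesis by (metis PiE_mem lessThan_iff)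
      qed
      ultimately have "a 0 ?e \<noteq> a n ?e" using \<open>d \<ge> 2\<close> by (auto simp: mod_Suc)
      then show ?thesis by (auto simp: a_def)
    qed
  qed
qed

text \<open>Each cover raises the girth bound by one, keeps \<open>s\<close>, and multiplies the
  number of points by the number of counter assignments, a power of \<open>d\<close>.\<close>

lemma exists_girth_system:
  fixes X :: "nat set"
  assumes "finite I" "d \<ge> 2" "uniform_system I X R s"
  shows "\<exists>e (Y :: nat set) S. uniform_system I Y S s \<and> girth_at_least I S g \<and> card Y = card X * d ^ e"
proof (induction g)
  case 0
  have "girth_at_least I R 0" by (simp add: girth_at_least_def)
  moreover have "card X = card X * d ^ 0" by simp
  ultimately show ?case using assms(3) by blast
next
  case (Suc g)
  then obtain e and Y :: "nat set" and S where Y: "uniform_system I Y S s" "girth_at_least I S g"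
    "card Y = card X * d ^ e" by blast
  let ?Z = "Y \<times> (Y \<times> I \<rightarrow>\<^sub>E {..<d})"
  let ?R = "cover_rel d I Y S"
  have sys: "uniform_system I ?Z ?R s" by (rule uniform_system_cover[OF Y(1) assms(1)])
  have fin: "finite Y" using Y(1) by (simp add: uniform_system_def)
  have "finite ?Z" using sys by (simp add: uniform_system_def)
  then obtain f where f: "bij_betw f {0..<card ?Z} ?Z" using ex_bij_betw_nat_finite by blast
  let ?S = "\<lambda>i. {(u, v). u \<in> {0..<card ?Z} \<and> v \<in> {0..<card ?Z} \<and> (f u, f v) \<in> ?R i}"
  have "uniform_system I {0..<card ?Z} ?S s" by (rule uniform_system_transfer[OF sys f])
  moreover have "girth_at_least I ?S (Suc g)"
    by (rule girth_at_least_map[OF girth_cover[OF Y(1) assms(1,2) Y(2)], of _ f])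
       (use bij_betw_imp_inj_on[OF f] in \<open>auto dest: inj_onD\<close>)
  moreover have "card {0..<card ?Z} = card X * d ^ (e + card (Y \<times> I))"
    using fin assms(1) Y(3) by (simp add: card_cartesian_product card_PiE power_add)
  ultimately show ?case by blast
qed

section \<open>Matching two equivalence relations\<close>

text \<open>Equal class sizes on equally many points give equally many classes. A bijection
  \<open>h\<close> of the classes is combined with bijections \<open>f A\<close> from each class
  \<open>A\<close> onto \<open>h A\<close>.\<close>

lemma bij_betw_equiv_classes:
  assumes R: "equiv X R" "\<And>x. x \<in> X \<Longrightarrow> card (R `` {x}) = s"
    and S: "equiv Y S" "\<And>y. y \<in> Y \<Longrightarrow> card (S `` {y}) = s"
    and fin: "finite X" "finite Y" and card: "card X = card Y" and "s > 0"
  shows "\<exists>f. bij_betw f X Y \<and> (\<forall>x\<in>X. \<forall>x'\<in>X. (x, x') \<in> R \<longleftrightarrow> (f x, f x') \<in> S)"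
proof -
  have count: "s * card (Z // Q) = card Z" "finite (Z // Q)"
    if "equiv Z Q" "finite Z" "\<And>z. z \<in> Z \<Longrightarrow> card (Q `` {z}) = s" for Z :: "'c set" and Q
  proof -
    show "finite (Z // Q)" unfolding quotient_def using that(2) by auto
    moreover have "card A = s" if "A \<in> Z // Q" for A
      using that \<open>\<And>z. z \<in> Z \<Longrightarrow> card (Q `` {z}) = s\<close> by (auto elim: quotientE)
    moreover have "A \<inter> B = {}" if "A \<in> Z // Q" "B \<in> Z // Q" "A \<noteq> B" for A B
      using quotient_disj[OF \<open>equiv Z Q\<close> that(1,2)] that(3) by blast
    ultimately show "s * card (Z // Q) = card Z"
      using card_partition[of "Z // Q" s] Union_quotient[OF that(1)] that(2) by simp
  qed
  have "card (X // R) = card (Y // S)"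
    using count(1)[OF R(1) fin(1) R(2)] count(1)[OF S(1) fin(2) S(2)] card \<open>s > 0\<close>
    by (metis mult_cancel1 less_not_refl)
  then obtain h where h: "bij_betw h (X // R) (Y // S)"
    using count(2)[OF R(1) fin(1) R(2)] count(2)[OF S(1) fin(2) S(2)] finite_same_card_bij by metis
  have cls: "finite A \<and> card A = s" if "A \<in> X // R" for A
    using that R(2) fin(1) equiv_class_subset[OF R(1)] \<open>s > 0\<close>
    by (metis card_ge_0_finite quotientE)
  have cls': "finite A \<and> card A = s" if "A \<in> Y // S" for A
    using that S(2) \<open>s > 0\<close> by (metis card_ge_0_finite quotientE)
  have "\<exists>f. bij_betw f A (h A)" if "A \<in> X // R" for A
    using finite_same_card_bij cls[OF that] cls'[OF bij_betw_apply[OF h that]] by metis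
  then obtain f where f: "\<And>A. A \<in> X // R \<Longrightarrow> bij_betw (f A) A (h A)" by metis
  define F where "F x = f (R `` {x}) x" for x
  have q: "R `` {x} \<in> X // R" "x \<in> R `` {x}" if "x \<in> X" for x
    using that equiv_class_self[OF R(1)] by (auto simp: quotientI)
  have Fh: "F x \<in> h (R `` {x})" if "x \<in> X" for x
    unfolding F_def using bij_betw_apply[OF f] q[OF that] by blast
  have hq: "h (R `` {x}) \<in> Y // S" if "x \<in> X" for x
    using bij_betw_apply[OF h] q[OF that] by blast
  have rel: "(x, x') \<in> R \<longleftrightarrow> (F x, F x') \<in> S" if x: "x \<in> X" "x' \<in> X" for x x'
  proof
    assume "(x, x') \<in> R"
    then have "R `` {x} = R `` {x'}" using R(1) by (simp add: equiv_class_eq)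
    then have "F x' \<in> h (R `` {x})" using Fh[OF x(2)] by simp
    then show "(F x, F x') \<in> S"
      using quotient_eq_iff[OF S(1) hq[OF x(1)] hq[OF x(1)] Fh[OF x(1)]] by blast
  next
    assume "(F x, F x') \<in> S"
    then have "h (R `` {x}) = h (R `` {x'})"
      using quotient_eqI[OF S(1) hq[OF x(1)] hq[OF x(2)] Fh[OF x(1)] Fh[OF x(2)]] by blast
    then have "R `` {x} = R `` {x'}"
      using bij_betw_imp_inj_on[OF h] q(1)[OF x(1)] q(1)[OF x(2)] by (auto dest: inj_onD)
    then show "(x, x') \<in> R" using eq_equiv_class[OF _ R(1) x(2)] by blast
  qed
  have inj: "inj_on F X"
  proof (rule inj_onI)
    fix x x' assume x: "x \<in> X" "x' \<in> X" and eq: "F x = F x'"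
    have "F x \<in> Y" using Fh[OF x(1)] hq[OF x(1)] in_quotient_imp_subset[OF S(1)] by blast
    then have "(F x, F x') \<in> S" using eq S(1) by (auto simp: equiv_def refl_on_def)
    then have "(x, x') \<in> R" using rel x by blast
    then have same: "R `` {x} = R `` {x'}" using R(1) by (simp add: equiv_class_eq)
    then have "f (R `` {x}) x = f (R `` {x}) x'" using eq by (simp add: F_def)
    then show "x = x'"
      using bij_betw_imp_inj_on[OF f[OF q(1)[OF x(1)]]] q(2)[OF x(1)] q(2)[OF x(2)] same
      by (auto dest: inj_onD)
  qed
  moreover have "F ` X \<subseteq> Y"
    using Fh hq in_quotient_imp_subset[OF S(1)] by blast
  ultimately have "F ` X = Y" using card fin by (intro card_subset_eq) (auto simp: card_image)
  with inj rel show ?thesis by (auto simp: bij_betw_def)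
qed

section \<open>Cycles in clique trees\<close>

text \<open>A cycle as a periodic function on all of \<open>nat\<close>: changing the starting point
  is a mere index shift, without wrap-around.\<close>

definition cyclic_path :: "('a \<times> 'a) set \<Rightarrow> nat \<Rightarrow> (nat \<Rightarrow> 'a) \<Rightarrow> bool" where
  "cyclic_path E h v \<longleftrightarrow>
     h > 0 \<and> inj_on v {..<h} \<and> (\<forall>j. v (j + h) = v j) \<and> (\<forall>j. (v j, v (Suc j)) \<in> E)"

lemma cyclic_path_mod:
  assumes "cyclic_path E h v"
  shows "v (j mod h) = v j"
proof -
  have "v (i + h * n) = v i" for i n
  proof (induction n)
    case (Suc n)
    have "v (i + h * n + h) = v (i + h * n)" using assms by (simp add: cyclic_path_def)
    then show ?case using Suc by (simp add: ac_simps)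
  qed simp
  from this[of "j mod h" "j div h"] show ?thesis by simp
qed

lemma cyclic_path_shift:
  assumes "cyclic_path E h v"
  shows "cyclic_path E h (\<lambda>j. v (s + j))"
proof -
  have "inj_on (\<lambda>j. v (s + j)) {..<h}"
  proof (rule inj_onI)
    have *: "i = j" if "i \<le> j" "j < h" "v (s + i) = v (s + j)" for i j
    proof -
      have "v ((s + i) mod h) = v ((s + j) mod h)" using that(3) cyclic_path_mod[OF assms] by simp
      then have "(s + i) mod h = (s + j) mod h"
        using assms unfolding cyclic_path_def inj_on_def by simp
      then have "h dvd (s + j) - (s + i)" using that(1) by (subst mod_eq_dvd_iff_nat[symmetric]) auto
      then show "i = j" using that by (auto dest: dvd_imp_le)
    qed
    fix i j assume "i \<in> {..<h}" "j \<in> {..<h}" "v (s + i) = v (s + j)"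
    then show "i = j" using *[of i j] *[of j i] by (cases "i \<le> j") auto
  qed
  with assms show ?thesis by (simp add: cyclic_path_def add.assoc[symmetric])
qed

lemma cyclic_path_of_cycle:
  assumes "has_cycle_of_length G h"
  obtains v where "cyclic_path (parcs G) h v"
proof -
  obtain p u where p: "set p \<subseteq> parcs G" "pcas u p u" "distinct (tl (pawalk_verts u p))"
    "p \<noteq> []" "length p = h"
    using assms
    by (auto simp: has_cycle_of_length_def pre_digraph.cycle_def pre_digraph.awalk_def
        cas_with_proj_eq awalk_verts_with_proj_eq)
  have verts: "tl (pawalk_verts u p) = map snd p" if "pcas u p w" for u p and w :: 'a
    using that
  proof (induction p arbitrary: u)
    case (Cons e p)
    then show ?case by (cases p) auto
  qed simp
  have consec: "snd (p ! j) = fst (p ! Suc j)" if "pcas u p w" "Suc j < length p" for u p j and w :: 'a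
    using that
  proof (induction p arbitrary: u j)
    case (Cons e p)
    then show ?case by (cases j; cases p) auto
  qed simp
  have ends: "fst (hd p) = u \<and> snd (last p) = w" if "pcas u p w" "p \<noteq> []" for u p and w :: 'a
    using that
  proof (induction p arbitrary: u)
    case (Cons e p)
    then show ?case by (cases p) auto
  qed simp
  have h: "h > 0" using p by auto
  \<comment> \<open>Heads of arcs are taken because the library requires distinctness of the tail of
    the vertex list, which consists of the heads.\<close>
  define v where "v j = snd (p ! (j mod h))" for j
  have "inj_on v {..<h}"
  proof (rule inj_onI)
    fix i j assume ij: "i \<in> {..<h}" "j \<in> {..<h}" "v i = v j"
    then have "map snd p ! i = map snd p ! j" using p(5) by (simp add: v_def)
    then show "i = j" using p(3,5) verts[OF p(2)] ij(1,2) nth_eq_iff_index_eq[of "map snd p" i j] by simp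
  qed
  moreover have "(v j, v (Suc j)) \<in> parcs G" for j
  proof -
    let ?n = "Suc j mod h"
    have "snd (p ! (j mod h)) = fst (p ! ?n)"
    proof (cases "Suc (j mod h) = h")
      case True
      then have "?n = 0" "j mod h = h - 1" by (auto simp: mod_Suc)
      then show ?thesis using ends[OF p(2,4)] p(4,5) by (simp add: hd_conv_nth last_conv_nth)
    next
      case False
      then have "?n = Suc (j mod h)" by (simp add: mod_Suc)
      moreover have "?n < h" using h by simp
      ultimately show ?thesis using consec[OF p(2), of "j mod h"] p(5) by simp
    qed
    moreover have "p ! ?n \<in> parcs G" using p(1,5) h by (meson mod_less_divisor nth_mem subsetD)
    ultimately show ?thesis by (simp add: v_def)
  qed
  ultimately have "cyclic_path (parcs G) h v" using h by (simp add: cyclic_path_def v_def)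
  then show thesis by (rule that)
qed

text \<open>
  A cycle passes through the cut vertex \<open>p\<close> at most once, so it cannot leave \<open>S\<close> and come back.
\<close>

lemma cyclic_path_confined:
  assumes cyc: "cyclic_path E h w" and start: "w s \<in> S"
    and closed: "\<And>i. w i \<in> S \<Longrightarrow> w (Suc i) \<in> insert p S"
      "\<And>i. w (Suc i) \<in> S \<Longrightarrow> w i \<in> insert p S"
  shows "w j \<in> insert p S"
proof -
  define v where "v j = w (s + j)" for j
  have v: "cyclic_path E h v" using cyclic_path_shift[OF cyc] by (simp add: v_def[abs_def])
  have v0: "v 0 \<in> S" "v h \<in> S" using start v by (auto simp: v_def cyclic_path_def dest: spec[of _ 0])
  have fwd: "v (Suc i) \<in> insert p S" if "v i \<in> S" for i
    using closed(1)[of "s + i"] that by (simp add: v_def)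
  have bwd: "v i \<in> insert p S" if "v (Suc i) \<in> S" for i
    using closed(2)[of "s + i"] that by (simp add: v_def)
  have main: "v i \<in> insert p S" if "i < h" for i
  proof (rule ccontr)
    assume out: "v i \<notin> insert p S"
    \<comment> \<open>Getting out of \<open>S\<close> before time \<open>i\<close> costs one visit
      to \<open>p\<close>, getting back by time \<open>h\<close> another; injectivity forbids
      both.\<close>
    have "\<exists>m<i. v m = p"
    proof (rule ccontr)
      assume no: "\<not> (\<exists>m<i. v m = p)"
      have "v m \<in> S" if "m < i" for m
        using that by (induction m) (use v0 fwd no in \<open>auto dest: Suc_lessD\<close>)
      moreover have "i \<noteq> 0" using out v0 by (cases i) auto
      ultimately show False using fwd[of "i - 1"] out by simp
    qed
    moreover have "\<exists>m. i < m \<and> m < h \<and> v m = p"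
    proof (rule ccontr)
      assume no: "\<not> (\<exists>m. i < m \<and> m < h \<and> v m = p)"
      have "v (h - m) \<in> S" if "i < h - m" for m
        using that
      proof (induction m)
        case (Suc m)
        then have "Suc (h - Suc m) = h - m" by simp
        then show ?case using bwd[of "h - Suc m"] Suc no by auto
      qed (use v0 in simp)
      from this[of "h - Suc i"] have "i + 1 < h \<Longrightarrow> v (Suc i) \<in> S" by simp
      moreover have "i + 1 = h \<Longrightarrow> v (Suc i) \<in> S" using v0 by simp
      ultimately show False using bwd[of i] out \<open>i < h\<close> by fastforce
    qed
    ultimately obtain m m' where "m < i" "i < m'" "m' < h" "v m = v m'" by metis
    then show False using v by (auto simp: cyclic_path_def dest: inj_onD)
  qed
  obtain i where "i < h" "v i = w j"
  proof
    have h: "h > 0" using cyc by (simp add: cyclic_path_def)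
    \<comment> \<open>The summand \<open>s * h\<close> keeps the subtraction of natural numbers
      exact and vanishes modulo \<open>h\<close>.\<close>
    let ?i = "(j + s * h - s) mod h"
    show "?i < h" using h by simp
    have "s \<le> s * h" using h by (cases h) auto
    then have "s + (j + s * h - s) = j + s * h" by (intro le_add_diff_inverse trans_le_add2)
    then have "v ?i = w (j + s * h)" unfolding cyclic_path_mod[OF v] by (simp add: v_def)
    then show "v ?i = w j" by (metis cyclic_path_mod[OF cyc] mod_mult_self1)
  qed
  then show ?thesis using main by metis
qed

text \<open>The cliques \<open>K_k\<close> of the tree: \<open>p\<close> with the
  \<open>u\<close>-th copy of \<open>K_(k-1)\<close> attached to it. The initial clique is
  \<open>block k [] 1\<close>.\<close>

definition block :: "nat \<Rightarrow> label \<Rightarrow> nat \<Rightarrow> label set" where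
  "block k p u = insert p ((\<lambda>l. p @ [(u, l)]) ` {1..k-1})"

lemma clique_tree_edge:
  "(x, y) \<in> parcs (clique_tree t k i) \<Longrightarrow> \<exists>p u. x \<in> block k p u \<and> y \<in> block k p u"
proof (induction t k i arbitrary: x y rule: clique_tree.induct)
  case (2 t k)
  then have "x \<in> block k [] 1 \<and> y \<in> block k [] 1"
    by (auto simp: complete_graph_on_def block_def)
  then show ?case by blast
next
  case (3 t k i)
  from 3(2) consider "(x, y) \<in> parcs (clique_tree t k (Suc i))"
    | p u l l' where "x = p @ [(u, l)]" "y = p @ [(u, l')]" "l \<in> {1..k-1}" "l' \<in> {1..k-1}"
    | p u l where "x = p" "y = p @ [(u, l)]" "l \<in> {1..k-1}"
    | p u l where "y = p" "x = p @ [(u, l)]" "l \<in> {1..k-1}"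
    unfolding clique_tree.simps attach_copies_def disjoint_copies_def complete_graph_on_def
    by (simp only: pair_pre_digraph.select_convs Un_iff) blast
  then show ?case
  proof cases
    case 1
    then show ?thesis by (rule 3(1))
  next
    case (2 p u)
    then show ?thesis by (intro exI[of _ p] exI[of _ u]) (simp add: block_def)
  next
    case (3 p u)
    then show ?thesis by (intro exI[of _ p] exI[of _ u]) (simp add: block_def)
  next
    case (4 p u)
    then show ?thesis by (intro exI[of _ p] exI[of _ u]) (simp add: block_def)
  qed
qed (simp add: complete_graph_on_def)

text \<open>Every member of the block extends \<open>p\<close>, and \<open>r < length x\<close>
  forces \<open>r \<le> length p\<close>.\<close>

lemma block_take:
  assumes "x \<in> block k p u" "y \<in> block k p u" "r < length x"
  shows "take r x = take r y"
proof -
  have "take r z = take r p" if "z \<in> block k p u" for z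
  proof -
    have "r \<le> length p" using assms by (auto simp: block_def)
    then show ?thesis using that by (auto simp: block_def)
  qed
  then show ?thesis using assms by metis
qed

lemma block_length:
  assumes "x \<in> block k p u" "y \<in> block k p u"
  shows "length x \<le> Suc (length y)"
  using assms by (auto simp: block_def)

text \<open>A deepest vertex of the cycle is a child in some block. From a child at maximal depth
  the cycle can only move inside the block, whose \<open>p\<close> is a cut vertex; so it stays
  among at most \<open>k\<close> vertices.\<close>

lemma clique_tree_cycle:
  assumes cyc: "cyclic_path (parcs (clique_tree t k q)) h w" and "k \<ge> 2"
  shows "h \<le> k"
proof -
  have h: "h > 0" using cyc by (simp add: cyclic_path_def)
  have edge: "(w j, w (Suc j)) \<in> parcs (clique_tree t k q)" for j
    using cyc by (simp add: cyclic_path_def)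
  obtain s where s: "\<And>j. j < h \<Longrightarrow> length (w j) \<le> length (w s)"
  proof -
    let ?M = "Max (length ` w ` {..<h})"
    have "?M \<in> length ` w ` {..<h}" by (rule Max_in) (use h in auto)
    then obtain s where "?M = length (w s)" by blast
    moreover have "length (w j) \<le> ?M" if "j < h" for j using that by (intro Max_ge) auto
    ultimately show thesis by (intro that[of s]) simp
  qed
  have max: "length (w j) \<le> length (w s)" for j
    using s[of "j mod h"] h cyclic_path_mod[OF cyc, of j] by simp
  have next_block: "\<exists>p u. w j \<in> block k p u \<and> w (Suc j) \<in> block k p u" for j
    by (rule clique_tree_edge[OF edge])
  obtain p u where pu: "w s \<in> (\<lambda>l. p @ [(u, l)]) ` {1..k-1}"
  proof -
    obtain p u where *: "w s \<in> block k p u" "w (Suc s) \<in> block k p u" using next_block by blast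
    have "w s \<noteq> w (Suc s)" using clique_tree_arcs[OF edge] by blast
    \<comment> \<open>If \<open>w s\<close> were \<open>p\<close>, its successor would be a child of
      \<open>p\<close> and so deeper.\<close>
    then have "w s \<noteq> p" using * max[of "Suc s"] by (auto simp: block_def)
    then show thesis using * that by (auto simp: block_def)
  qed
  let ?S = "(\<lambda>l. p @ [(u, l)]) ` {1..k-1}"
  have len: "length (w j) \<le> Suc (length p)" for j using max[of j] pu by auto
  have nbr: "y \<in> insert p ?S" if "x \<in> ?S" "x \<in> block k p' u'" "y \<in> block k p' u'"
    "length y \<le> Suc (length p)" for x y p' u'
    using that by (auto simp: block_def)
  have "w j \<in> insert p ?S" for j
  proof (rule cyclic_path_confined[OF cyc pu])
    show "w (Suc i) \<in> insert p ?S" if "w i \<in> ?S" for i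
      using next_block[of i] nbr[OF that _ _ len] by blast
    show "w i \<in> insert p ?S" if "w (Suc i) \<in> ?S" for i
      using next_block[of i] nbr[OF that _ _ len] by blast
  qed
  then have "card (w ` {..<h}) \<le> card (insert p ?S)" by (intro card_mono) auto
  also have "\<dots> \<le> Suc (card ?S)" by (rule card_insert_le_m1) auto
  also have "\<dots> \<le> Suc (k - 1)" using card_image_le[of "{1..k-1}" "\<lambda>l. p @ [(u, l)]"] by simp
  finally show ?thesis using cyc \<open>k \<ge> 2\<close> by (simp add: cyclic_path_def card_image)
qed

section \<open>Labels with a common prefix\<close>

definition same_prefix :: "nat \<Rightarrow> nat \<Rightarrow> nat \<Rightarrow> nat \<Rightarrow> (label \<times> label) set" where
  "same_prefix t k q r = {(x, y). x \<in> level t k q \<and> y \<in> level t k q \<and> take r x = take r y}"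

text \<open>The recursion appends columns at the end; counting extensions of a prefix needs this
  explicit form.\<close>

lemma level_Suc_iff:
  "w \<in> level t k (Suc i) \<longleftrightarrow>
     (\<exists>l us. w = (1, l) # us \<and> l \<in> {1..k-1} \<and> set us \<subseteq> {1..t-1} \<times> {1..k-1} \<and> length us = i)"
proof (induction i arbitrary: w)
  case (Suc i)
  show ?case
  proof
    assume "w \<in> level t k (Suc (Suc i))"
    then obtain w' u v where w: "w = w' @ [(u, v)]" "w' \<in> level t k (Suc i)"
      "u \<in> {1..t-1}" "v \<in> {1..k-1}" by auto
    then obtain l us where "w' = (1, l) # us" "l \<in> {1..k-1}" "set us \<subseteq> {1..t-1} \<times> {1..k-1}"
      "length us = i" using Suc by blast
    then show "\<exists>l us. w = (1, l) # us \<and> l \<in> {1..k-1} \<and> set us \<subseteq> {1..t-1} \<times> {1..k-1}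
        \<and> length us = Suc i"
      using w by (intro exI[of _ l] exI[of _ "us @ [(u, v)]"]) auto
  next
    assume "\<exists>l us. w = (1, l) # us \<and> l \<in> {1..k-1} \<and> set us \<subseteq> {1..t-1} \<times> {1..k-1}
        \<and> length us = Suc i"
    then obtain l us where w: "w = (1, l) # us" "l \<in> {1..k-1}" "set us \<subseteq> {1..t-1} \<times> {1..k-1}"
      "length us = Suc i" by blast
    obtain us' u v where us: "us = us' @ [(u, v)]" using w(4) by (metis length_Suc_conv_rev surj_pair)
    have "(1, l) # us' \<in> level t k (Suc i)" using Suc w us by auto
    then show "w \<in> level t k (Suc (Suc i))" using w us by auto
  qed
qed auto

lemma equiv_same_prefix: "equiv (level t k q) (same_prefix t k q r)"
  by (rule equivI) (auto simp: same_prefix_def refl_on_def sym_def trans_def)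

text \<open>The last \<open>q - r\<close> columns are free. As \<open>1 \<le> r\<close>, the
  exceptional first column, with only \<open>k - 1\<close> values, belongs to the fixed
  prefix.\<close>

lemma card_same_prefix:
  assumes "1 \<le> r" "r \<le> q" and w: "w \<in> level t k q"
  shows "card (same_prefix t k q r `` {w}) = ((t - 1) * (k - 1)) ^ (q - r)"
proof -
  let ?C = "{1..t-1} \<times> {1..k-1}"
  obtain i where q: "q = Suc i" using assms by (cases q) auto
  obtain l us where w': "w = (1, l) # us" "l \<in> {1..k-1}" "set us \<subseteq> ?C" "length us = i"
    using w unfolding q level_Suc_iff by blast
  obtain r' where r: "r = Suc r'" using assms by (cases r) auto
  have "same_prefix t k q r `` {w}
      = (\<lambda>vs. take r w @ vs) ` {vs. set vs \<subseteq> ?C \<and> length vs = q - r}" (is "?L = ?F ` ?V")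
  proof (intro set_eqI iffI)
    fix x assume "x \<in> ?L"
    then have x: "x \<in> level t k q" "take r w = take r x" by (auto simp: same_prefix_def)
    obtain m vs where x': "x = (1, m) # vs" "set vs \<subseteq> ?C" "length vs = i"
      using x unfolding q level_Suc_iff by blast
    have "x = take r w @ drop r x" using x by simp
    moreover have "drop r x \<in> ?V"
      using x' r q set_drop_subset[of r' vs] by auto
    ultimately show "x \<in> ?F ` ?V" by blast
  next
    fix x assume "x \<in> ?F ` ?V"
    then obtain vs where vs: "x = take r w @ vs" "set vs \<subseteq> ?C" "length vs = q - r" by blast
    have "x = (1, l) # (take r' us @ vs)" using vs w' r by simp
    moreover have "set (take r' us @ vs) \<subseteq> ?C" using vs w' set_take_subset[of r' us] by auto
    moreover have "length (take r' us @ vs) = i" using vs w' assms(2) q r by simp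
    ultimately have "x \<in> level t k q" unfolding q level_Suc_iff using w'(2) by blast
    moreover have "take r x = take r w" using vs w' assms(2) q by simp
    ultimately show "x \<in> ?L" using w by (simp add: same_prefix_def)
  qed
  moreover have "inj_on ?F ?V" by (auto simp: inj_on_def)
  ultimately have "card ?L = card ?V" using card_image by fastforce
  then show ?thesis by (simp add: card_lists_length_eq card_cartesian_product)
qed

section \<open>Cycles in the glued graph\<close>

text \<open>The relation \<open>R i\<close> of the overview. Glued leaves are named by their index
  \<open>j\<close>, and glued leaf \<open>j\<close> is in copy \<open>i\<close> the leaf of rank
  \<open>\<pi> i j\<close>.\<close>

definition position_rel ::
  "nat \<Rightarrow> nat \<Rightarrow> nat \<Rightarrow> nat \<Rightarrow> (nat \<Rightarrow> nat \<Rightarrow> nat) \<Rightarrow> nat \<Rightarrow> (nat \<times> nat) set" where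
  "position_rel t k q r \<pi> i = {(j, j'). j \<in> {1..level_size t k q} \<and> j' \<in> {1..level_size t k q}
      \<and> (\<exists>x x'. (x, x') \<in> same_prefix t k q r
            \<and> level_pos t k q x = \<pi> i j \<and> level_pos t k q x' = \<pi> i j')}"

context
  fixes t k q :: nat and \<pi> :: "nat \<Rightarrow> nat \<Rightarrow> nat"
  assumes q: "q \<ge> 1" and perm: "\<And>i. i \<in> {1..t} \<Longrightarrow> \<pi> i permutes {1..level_size t k q}"
begin

abbreviation glued_vertex :: "nat \<Rightarrow> label \<Rightarrow> (nat \<times> label) set" where
  "glued_vertex i x \<equiv> glue_rel t k q \<pi> `` {(i, x)}"

lemma glue_iff:
  "((i, x), (i', x')) \<in> glue_rel t k q \<pi> \<longleftrightarrow>
     i \<in> {1..t} \<and> i' \<in> {1..t} \<and>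
     (i = i' \<and> x = x' \<and> x \<in> pverts (clique_tree t k q)
      \<or> x = root \<and> x' = root
      \<or> x \<in> level t k q \<and> x' \<in> level t k q
        \<and> (\<exists>j\<in>{1..level_size t k q}. level_pos t k q x = \<pi> i j \<and> level_pos t k q x' = \<pi> i' j))"
  by (rule glue_rel_iff[OF q perm])

lemma glue_same_copy: "((i, x), (i, y)) \<in> glue_rel t k q \<pi> \<Longrightarrow> x = y"
  by (rule glue_rel_same_copy[OF q perm])

lemma glued_edge:
  assumes "(A, B) \<in> parcs (glued_graph t k q \<pi>)"
  shows "\<exists>i x y. i \<in> {1..t} \<and> (x, y) \<in> parcs (clique_tree t k q) \<and> A = glued_vertex i x \<and> B = glued_vertex i y"
  using assms by (auto simp: glued_graph_def identify_vertices_def disjoint_copies_def)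

lemma glued_vertex_eq_iff:
  assumes "i \<in> {1..t}" "i' \<in> {1..t}"
    "x \<in> pverts (clique_tree t k q)" "x' \<in> pverts (clique_tree t k q)"
  shows "glued_vertex i x = glued_vertex i' x' \<longleftrightarrow> ((i, x), (i', x')) \<in> glue_rel t k q \<pi>"
  by (rule eq_equiv_class_iff[OF equiv_glue_rel[OF q perm]])
     (use assms in \<open>auto simp: disjoint_copies_def\<close>)

text \<open>If the copy never changes, \<open>clique_tree_cycle\<close> bounds \<open>h\<close> by
  \<open>k\<close>. Otherwise each maximal run of edges in one copy joins two leaves with a common
  prefix, and contracting the runs gives a closed reduced walk with at most \<open>h\<close>
  steps.\<close>

lemma glued_graph_long_cycle:
  assumes k: "k \<ge> 2" and g: "g < q" and h: "k < h" "h < g"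
    and girth: "girth_at_least {1..t} (position_rel t k q (q - g) \<pi>) g"
  shows "\<not> has_cycle_of_length (glued_graph t k q \<pi>) h"
proof
  assume "has_cycle_of_length (glued_graph t k q \<pi>) h"
  then obtain v0 where v0: "cyclic_path (parcs (glued_graph t k q \<pi>)) h v0"
    by (rule cyclic_path_of_cycle)
  then have "\<forall>j. \<exists>i x y. i \<in> {1..t} \<and> (x, y) \<in> parcs (clique_tree t k q) \<and> v0 j = glued_vertex i x
      \<and> v0 (Suc j) = glued_vertex i y"
    by (intro allI glued_edge) (simp add: cyclic_path_def)
  \<comment> \<open>Edge \<open>j\<close> lies in copy \<open>c0 j\<close>. A vertex thus has two
    names: \<open>b0 j\<close> where edge \<open>j\<close> arrives and \<open>a0 (Suc j)\<close>
    where the next edge leaves.\<close>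
  then obtain c0 a0 b0 where c0: "\<And>j. c0 j \<in> {1..t}" "\<And>j. (a0 j, b0 j) \<in> parcs (clique_tree t k q)"
    "\<And>j. v0 j = glued_vertex (c0 j) (a0 j)" "\<And>j. v0 (Suc j) = glued_vertex (c0 j) (b0 j)"
    by metis
  \<comment> \<open>start at a leaf if there is one, else at the root if possible: then later changes of the copy
    only happen at leaves\<close>
  obtain s where s: "length (a0 s) = q
      \<or> (\<forall>j. length (a0 j) \<noteq> q) \<and> (length (a0 s) = 0 \<or> (\<forall>j. length (a0 j) \<noteq> 0))"
    by metis
  define v c a b where "v j = v0 (s + j)" and "c j = c0 (s + j)" and "a j = a0 (s + j)"
    and "b j = b0 (s + j)" for j
  have start: "length (a 0) = q
      \<or> (\<forall>j. length (a j) \<noteq> q) \<and> (length (a 0) = 0 \<or> (\<forall>j. length (a j) \<noteq> 0))"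
    using s unfolding a_def add_0_right by blast
  have v: "cyclic_path (parcs (glued_graph t k q \<pi>)) h v"
    using cyclic_path_shift[OF v0] by (simp add: v_def[abs_def])
  have c: "c j \<in> {1..t}" and edge: "(a j, b j) \<in> parcs (clique_tree t k q)"
    and va: "v j = glued_vertex (c j) (a j)" and vb: "v (Suc j) = glued_vertex (c j) (b j)" for j
    using c0 by (simp_all add: v_def c_def a_def b_def)
  have vinj: "v i \<noteq> v j" if "i < j" "j < h" for i j
    using v that by (auto simp: cyclic_path_def dest: inj_onD)
  have vh: "v h = v 0" using v by (auto simp: cyclic_path_def dest: spec[of _ 0])
  have verts: "a j \<in> pverts (clique_tree t k q)" "b j \<in> pverts (clique_tree t k q)" for j
    using clique_tree_arcs[OF edge[of j]] by auto
  have link: "((c j, b j), (c (Suc j), a (Suc j))) \<in> glue_rel t k q \<pi>" for j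
    using va[of "Suc j"] vb[of j] glued_vertex_eq_iff[OF c c verts(2) verts(1)] by simp
  have same: "b j = a (Suc j)" if "c j = c (Suc j)" for j
    using glue_same_copy link[of j] that by simp
  have len: "length x = length x'" if "((i, x), (i', x')) \<in> glue_rel t k q \<pi>" for i x i' x'
    using that length_level unfolding glue_iff by auto
  have len_b: "length (b j) = length (a (Suc j))" for j by (rule len[OF link])
  have level: "length (a j) = q \<longleftrightarrow> a j \<in> level t k q" for j
    using verts(1)[of j] length_level[of "a j" t k] unfolding pverts_clique_tree by auto
  \<comment> \<open>An edge climbs at most one level, and gluing preserves levels.\<close>
  have low: "length (a j) \<ge> q - j" if "length (a 0) = q" for j
  proof (induction j)
    case (Suc j)
    obtain p u where "a j \<in> block k p u" "b j \<in> block k p u"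
      using clique_tree_edge[OF edge] by blast
    then have "length (a j) \<le> Suc (length (b j))" by (rule block_length)
    then show ?case using Suc len_b[of j] by simp
  qed (use that in simp)
  have change: "a (Suc j) \<in> level t k q" if "c j \<noteq> c (Suc j)" "Suc j < h" for j
  proof -
    \<comment> \<open>From a leaf the root is too far away to be reached. If there is no leaf but
      the root occurs, the cycle starts at the root and visits it only once.\<close>
    have "a (Suc j) \<noteq> root"
    proof
      assume r: "a (Suc j) = root"
      show False
      proof (cases "length (a 0) = q")
        case True
        from low[OF this, of "Suc j"] show False using r that(2) g h by simp
      next
        case False
        then have "a 0 = root" using start r by fastforce
        then have "((c 0, a 0), (c (Suc j), a (Suc j))) \<in> glue_rel t k q \<pi>"
          unfolding glue_iff using r c by blast
        then have "v 0 = v (Suc j)"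
          using va glued_vertex_eq_iff[OF c c verts(1) verts(1)] by metis
        then show False using vinj[of 0 "Suc j"] that(2) by simp
      qed
    qed
    then show ?thesis using link[of j] that(1) unfolding glue_iff by auto
  qed
  have mono: False if const: "\<And>j. j < h \<Longrightarrow> c j = c 0"
  proof -
    \<comment> \<open>The names \<open>a j\<close> were chosen separately for each index and need
      not be periodic.\<close>
    define w where "w j = a (j mod h)" for j
    have hpos: "h > 0" using h by simp
    have vw: "v j = glued_vertex (c 0) (w j)" for j
      using cyclic_path_mod[OF v, of j] va[of "j mod h"] const[of "j mod h"] hpos by (simp add: w_def)
    have "w (Suc j) = b (j mod h)" for j
    proof -
      have "v (Suc (j mod h)) = v (Suc j)"
        using cyclic_path_mod[OF v, of "Suc j"] cyclic_path_mod[OF v, of "Suc (j mod h)"]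
        by (simp add: mod_Suc_eq)
      then have "glued_vertex (c 0) (w (Suc j)) = glued_vertex (c 0) (b (j mod h))"
        using vb[of "j mod h"] const[of "j mod h"] hpos vw by simp
      then have "((c 0, w (Suc j)), (c 0, b (j mod h))) \<in> glue_rel t k q \<pi>"
        using glued_vertex_eq_iff[OF c c verts(1) verts(2)] by (simp add: w_def)
      then show ?thesis by (rule glue_same_copy)
    qed
    then have "(w j, w (Suc j)) \<in> parcs (clique_tree t k q)" for j using edge by (simp add: w_def)
    moreover have "inj_on w {..<h}"
      using v vw unfolding cyclic_path_def inj_on_def by metis
    moreover have "w (j + h) = w j" for j by (simp add: w_def)
    ultimately have "cyclic_path (parcs (clique_tree t k q)) h w" using hpos by (simp add: cyclic_path_def)
    from clique_tree_cycle[OF this k] show False using h by simp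
  qed
  have a0: "a 0 \<in> level t k q"
  proof (rule ccontr)
    assume "a 0 \<notin> level t k q"
    then have no: "a j \<notin> level t k q" for j using start level by blast
    have "c j = c 0" if "j < h" for j
      using that by (induction j) (use change no Suc_lessD in metis)+
    then show False by (rule mono)
  qed
  have qlen: "length (a 0) = q" using a0 level by simp
  let ?R = "position_rel t k q (q - g) \<pi>"
  let ?M = "{1..level_size t k q}"
  note posbij = bij_betw_level_pos[OF q, of t k]
  \<comment> \<open>The index of the glued leaf \<open>v j\<close>, meaningful when
    \<open>a j\<close> is a leaf.\<close>
  define P where "P j = inv (\<pi> (c j)) (level_pos t k q (a j))" for j
  have \<pi>P: "\<pi> (c j) (P j) = level_pos t k q (a j)" for j
    unfolding P_def using permutes_inverses(1)[OF perm[OF c]] by simp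
  have P_mem: "P j \<in> ?M" if "a j \<in> level t k q" for j
    unfolding P_def using permutes_in_image[OF permutes_inv[OF perm[OF c]]]
      bij_betw_apply[OF posbij that] by blast
  have pinj: "x = y" if "\<pi> (c j) x = \<pi> (c j) y" for j x y
    using permutes_inj[OF perm[OF c]] that by (auto dest: injD)
  have P_eq: "P i = P j \<longleftrightarrow> v i = v j" if "a i \<in> level t k q" "a j \<in> level t k q" for i j
  proof -
    have root: "a i \<noteq> root" using length_level[OF that(1)] q by auto
    have "v i = v j \<longleftrightarrow> ((c i, a i), (c j, a j)) \<in> glue_rel t k q \<pi>"
      unfolding va by (rule glued_vertex_eq_iff[OF c c verts(1) verts(1)])
    also have "\<dots> \<longleftrightarrow> P i = P j"
    proof
      assume "P i = P j"
      then have "\<exists>p\<in>?M. level_pos t k q (a i) = \<pi> (c i) p \<and> level_pos t k q (a j) = \<pi> (c j) p"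
        using \<pi>P P_mem[OF that(1)] by metis
      then show "((c i, a i), (c j, a j)) \<in> glue_rel t k q \<pi>"
        unfolding glue_iff using that c by blast
    next
      assume "((c i, a i), (c j, a j)) \<in> glue_rel t k q \<pi>"
      then consider "c i = c j" "a i = a j"
        | p where "level_pos t k q (a i) = \<pi> (c i) p" "level_pos t k q (a j) = \<pi> (c j) p"
        unfolding glue_iff using root by metis
      then show "P i = P j"
      proof cases
        case 2
        then have "P i = p" "P j = p" using \<pi>P pinj by metis+
        then show ?thesis by simp
      qed (simp add: P_def)
    qed
    finally show ?thesis by simp
  qed
  have b_end: "b j \<in> level t k q \<and> level_pos t k q (b j) = \<pi> (c j) (P (Suc j))"
    if "a (Suc j) \<in> level t k q" for j
  proof -
    have root: "a (Suc j) \<noteq> root" using length_level[OF that] q by auto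
    consider "c j = c (Suc j)" "b j = a (Suc j)"
      | p where "b j \<in> level t k q" "level_pos t k q (b j) = \<pi> (c j) p"
          "level_pos t k q (a (Suc j)) = \<pi> (c (Suc j)) p"
      using link[of j] root unfolding glue_iff by blast
    then show ?thesis
    proof cases
      case 1
      then show ?thesis using that \<pi>P[of "Suc j"] by simp
    next
      case (2 p)
      then have "P (Suc j) = p" using \<pi>P[of "Suc j"] pinj by metis
      then show ?thesis using 2 by simp
    qed
  qed
  \<comment> \<open>All labels on the run are longer than \<open>q - g\<close>, so
    \<open>block_take\<close> carries the prefix along. The end of the run is read off as
    \<open>b (m - 1)\<close>, since \<open>a m\<close> may name it in another copy.\<close>
  have run: "(P m0, P m) \<in> ?R (c m0)"
    if m: "m0 < m" "m \<le> h" and ends: "a m0 \<in> level t k q" "a m \<in> level t k q"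
      and const: "\<And>j. m0 \<le> j \<Longrightarrow> j < m \<Longrightarrow> c j = c m0" for m0 m
  proof -
    have "take (q - g) (a m0) = take (q - g) (b (m0 + i))" if "m0 + i < m" for i
      using that
    proof (induction i)
      case 0
      obtain p u where "a m0 \<in> block k p u" "b m0 \<in> block k p u"
        using clique_tree_edge[OF edge] by blast
      moreover have "q - g < length (a m0)" using low[OF qlen, of m0] m g h by linarith
      ultimately have "take (q - g) (a m0) = take (q - g) (b m0)" by (rule block_take)
      then show ?case by simp
    next
      case (Suc i)
      obtain p u where "a (m0 + Suc i) \<in> block k p u" "b (m0 + Suc i) \<in> block k p u"
        using clique_tree_edge[OF edge] by blast
      moreover have "q - g < length (a (m0 + Suc i))"
        using low[OF qlen, of "m0 + Suc i"] Suc.prems m g h by linarith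
      ultimately have "take (q - g) (a (m0 + Suc i)) = take (q - g) (b (m0 + Suc i))"
        by (rule block_take)
      moreover have "b (m0 + i) = a (m0 + Suc i)"
        using same[of "m0 + i"] const[of "m0 + i"] const[of "m0 + Suc i"] Suc.prems by simp
      ultimately show ?case using Suc by simp
    qed
    from this[of "m - 1 - m0"] have "take (q - g) (a m0) = take (q - g) (b (m - 1))" using m by simp
    moreover have "b (m - 1) \<in> level t k q" "level_pos t k q (b (m - 1)) = \<pi> (c m0) (P m)"
      using b_end[of "m - 1"] const[of "m - 1"] m ends by auto
    ultimately have "(a m0, b (m - 1)) \<in> same_prefix t k q (q - g)"
      "level_pos t k q (b (m - 1)) = \<pi> (c m0) (P m)"
      using ends by (auto simp: same_prefix_def)
    then show ?thesis
      unfolding position_rel_def using P_mem ends \<pi>P[of m0, symmetric] by blast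
  qed
  \<comment> \<open>the run of edges in one copy that ends with edge \<open>m - 1\<close> starts at the leaf \<open>m0\<close>; the earlier
    runs have been contracted to the steps of a reduced walk\<close>
  define partial_walk where "partial_walk m n x d m0 \<longleftrightarrow> m0 < m \<and> n \<le> m0
      \<and> reduced_walk {1..t} ?R n x d \<and> x 0 = P 0 \<and> x n = P m0 \<and> a m0 \<in> level t k q
      \<and> (\<forall>j. m0 \<le> j \<and> j < m \<longrightarrow> c j = c m0) \<and> (\<forall>l. n = Suc l \<longrightarrow> d l \<noteq> c m0)" for m n x d m0
  have walk: "\<exists>n x d m0. partial_walk m n x d m0"
    if "1 \<le> m" "m \<le> h" for m
    using that
  proof (induction m rule: dec_induct)
    case base
    have "reduced_walk {1..t} ?R 0 (\<lambda>_. P 0) c" by (simp add: reduced_walk_def)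
    then have "partial_walk 1 0 (\<lambda>_. P 0) c 0" using a0 by (simp add: partial_walk_def)
    then show ?case by blast
  next
    case (step m)
    then obtain n x d m0 where "partial_walk m n x d m0" by auto
    then have IH: "m0 < m" "n \<le> m0" "reduced_walk {1..t} ?R n x d"
      "x 0 = P 0" "x n = P m0" "a m0 \<in> level t k q"
      "\<And>j. m0 \<le> j \<Longrightarrow> j < m \<Longrightarrow> c j = c m0" "\<And>l. n = Suc l \<Longrightarrow> d l \<noteq> c m0"
      unfolding partial_walk_def by blast+
    show ?case
    proof (cases "c m = c m0")
      case True
      then have "c j = c m0" if "m0 \<le> j" "j < Suc m" for j
        using that IH(7) True by (metis less_SucE)
      then have "partial_walk (Suc m) n x d m0"
        unfolding partial_walk_def using IH(1-6,8) less_SucI by blast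
      then show ?thesis by blast
    next
      case False
      have "c (m - 1) = c m0" using IH(1) IH(7)[of "m - 1"] by simp
      then have am: "a m \<in> level t k q" using change[of "m - 1"] False step.hyps step.prems by simp
      have "v m0 \<noteq> v m" using vinj IH(1) step.prems by simp
      then have "x n \<noteq> P m" using P_eq IH(5,6) am by simp
      moreover have "(x n, P m) \<in> ?R (c m0)"
        using run[OF IH(1) _ IH(6) am IH(7)] step.prems IH(5) by simp
      ultimately have "reduced_walk {1..t} ?R (Suc n) (x(Suc n := P m)) (d(n := c m0))"
        using reduced_walk_extend[OF IH(3) c] IH(8) by blast
      then have "partial_walk (Suc m) (Suc n) (x(Suc n := P m)) (d(n := c m0)) m"
        using IH(1,2,4) am False by (auto simp: partial_walk_def less_Suc_eq)
      then show ?thesis by blast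
    qed
  qed
  obtain n x d m0 where "partial_walk h n x d m0" using walk[of h] h by auto
  then have W: "m0 < h" "n \<le> m0" "reduced_walk {1..t} ?R n x d"
    "x 0 = P 0" "x n = P m0" "a m0 \<in> level t k q"
    "\<And>j. m0 \<le> j \<Longrightarrow> j < h \<Longrightarrow> c j = c m0" "\<And>l. n = Suc l \<Longrightarrow> d l \<noteq> c m0"
    unfolding partial_walk_def by blast+
  have "m0 \<noteq> 0"
  proof
    assume "m0 = 0"
    then have "c j = c 0" if "j < h" for j using W(7)[of j] that by simp
    then show False by (rule mono)
  qed
  \<comment> \<open>\<open>a h\<close> may name the starting vertex in another copy than
    \<open>a 0\<close> does; it is still a leaf.\<close>
  have "glued_vertex (c h) (a h) = glued_vertex (c 0) (a 0)" using vh va by simp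
  then have "length (a h) = q"
    using glued_vertex_eq_iff[OF c c verts(1) verts(1)] len length_level[OF a0] by metis
  then have ah: "a h \<in> level t k q" using level by simp
  have Ph: "P h = P 0" using P_eq[OF ah a0] vh by simp
  have "v 0 \<noteq> v m0" using vinj \<open>m0 \<noteq> 0\<close> W(1) by simp
  then have "x n \<noteq> P h" using P_eq[OF a0 W(6)] W(5) Ph by simp
  moreover have "(x n, P h) \<in> ?R (c m0)" using run[OF W(1) _ W(6) ah W(7)] W(5) by simp
  ultimately have "reduced_walk {1..t} ?R (Suc n) (x(Suc n := P h)) (d(n := c m0))"
    using reduced_walk_extend[OF W(3) c] W(8) by blast
  moreover have "1 \<le> Suc n" "Suc n < g" using W(1,2) h by auto
  ultimately have "(x(Suc n := P h)) 0 \<noteq> (x(Suc n := P h)) (Suc n)"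
    using girth unfolding girth_at_least_def by blast
  then show False using W(4) Ph by simp
qed

end

section \<open>Choice of \<open>q\<close> and of the permutations\<close>

text \<open>The initial system, with all relations equal, only has to have the right class size: on
  level \<open>g + 1\<close>, equality of first columns gives classes of size \<open>?d ^ g\<close>.
  That level has \<open>(k - 1) * ?d ^ g\<close> points, so a further factor \<open>?d ^ e\<close>
  gives the size of level \<open>g + 1 + e\<close>.\<close>

lemma exists_level_system:
  assumes "t > k" "k \<ge> 2"
  shows "\<exists>q (Y :: nat set) S. g < q \<and> card Y = level_size t k q
      \<and> uniform_system {1..t} Y S (((t - 1) * (k - 1)) ^ g) \<and> girth_at_least {1..t} S g"
proof -
  let ?d = "(t - 1) * (k - 1)"
  have d: "?d \<ge> 2"
  proof -
    have "2 * 1 \<le> (t - 1) * (k - 1)" using assms by (intro mult_le_mono) auto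
    then show ?thesis by simp
  qed
  let ?X = "level t k (Suc g)" and ?R = "\<lambda>i :: nat. same_prefix t k (Suc g) 1"
  have sys: "uniform_system {1..t} ?X ?R (?d ^ g)"
    unfolding uniform_system_def
    using finite_level equiv_same_prefix card_same_prefix[of 1 "Suc g" _ t k] by simp
  obtain f where f: "bij_betw f {0..<card ?X} ?X" using ex_bij_betw_nat_finite[OF finite_level] by blast
  obtain e and Y :: "nat set" and S where Y: "uniform_system {1..t} Y S (?d ^ g)"
    "girth_at_least {1..t} S g" "card Y = card {0..<card ?X} * ?d ^ e"
    using exists_girth_system[OF _ d uniform_system_transfer[OF sys f], of g] by blast
  have "card Y = level_size t k (Suc g + e)"
    using Y(3) card_level[of "Suc g" t k]
    by (simp add: level_size_def power_add power_mult_distrib)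
  then show ?thesis using Y by (intro exI[of _ "Suc g + e"] exI[of _ Y] exI[of _ S]) simp
qed

theorem theorem11:
  fixes t k g :: nat
  assumes "k \<ge> 2" and "t > k" and "g > k"
  shows "\<exists>q \<ge> 2. \<exists>\<pi> :: nat \<Rightarrow> nat \<Rightarrow> nat.
           (\<forall>i \<in> {1..t}. \<pi> i permutes {1..level_size t k q}) \<and> inj_on \<pi> {1..t} \<and>
           (\<forall>h. k < h \<and> h < g \<longrightarrow> \<not> has_cycle_of_length (glued_graph t k q \<pi>) h)"
proof -
  let ?s = "((t - 1) * (k - 1)) ^ g"
  obtain q and Y :: "nat set" and S where q: "g < q" and cardY: "card Y = level_size t k q"
    and sys: "uniform_system {1..t} Y S ?s" and girth: "girth_at_least {1..t} S g"
    using exists_level_system[OF assms(2,1)] by blast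
  have q1: "q \<ge> 1" using q by simp
  let ?r = "q - g" and ?L = "level t k q" and ?M = "{1..level_size t k q}"
  have s: "?s \<ge> 2"
  proof -
    have "2 * 1 \<le> (t - 1) * (k - 1)" using assms by (intro mult_le_mono) auto
    moreover have "(t - 1) * (k - 1) \<le> ?s" using assms by (intro self_le_power) auto
    ultimately show ?thesis by simp
  qed
  have cls: "card (same_prefix t k q ?r `` {x}) = ?s" if "x \<in> ?L" for x
    using card_same_prefix[OF _ _ that, of ?r] q by simp
  have finY: "finite Y" using sys by (simp add: uniform_system_def)
  \<comment> \<open>Every \<open>S i\<close> is matched with the same prefix relation, but by its
    own bijection; the permutations will record these bijections.\<close>
  have "\<exists>f. bij_betw f Y ?L \<and> (\<forall>y\<in>Y. \<forall>y'\<in>Y. (y, y') \<in> S i \<longleftrightarrow> (f y, f y') \<in> same_prefix t k q ?r)"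
    if "i \<in> {1..t}" for i
  proof (rule bij_betw_equiv_classes)
    show "card Y = card ?L" using cardY card_level q1 by simp
  qed (use assms that sys cls equiv_same_prefix finite_level in \<open>auto simp: uniform_system_def\<close>)
  then obtain F where F: "\<And>i. i \<in> {1..t} \<Longrightarrow> bij_betw (F i) Y ?L"
    "\<And>i y y'. i \<in> {1..t} \<Longrightarrow> y \<in> Y \<Longrightarrow> y' \<in> Y
       \<Longrightarrow> (y, y') \<in> S i \<longleftrightarrow> (F i y, F i y') \<in> same_prefix t k q ?r"
    by metis
  have "card ?M = card Y" using cardY by simp
  then obtain \<beta> where \<beta>: "bij_betw \<beta> ?M Y" using finite_same_card_bij finY by blast
  note posbij = bij_betw_level_pos[OF q1, of t k]
  \<comment> \<open>\<open>\<beta>\<close> numbers the points of \<open>Y\<close>; the value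
    \<open>j\<close> outside \<open>?M\<close> is what \<open>permutes\<close> demands.\<close>
  define \<pi> where "\<pi> i j = (if j \<in> ?M then level_pos t k q (F i (\<beta> j)) else j)" for i j
  have perm: "\<pi> i permutes ?M" if i: "i \<in> {1..t}" for i
  proof (rule bij_imp_permutes)
    have "bij_betw (level_pos t k q \<circ> (F i \<circ> \<beta>)) ?M ?M"
      by (intro bij_betw_trans[OF _ posbij] bij_betw_trans[OF \<beta> F(1)[OF i]])
    then show "bij_betw (\<pi> i) ?M ?M"
      by (rule bij_betw_cong[THEN iffD1, rotated]) (simp add: \<pi>_def)
  qed (auto simp: \<pi>_def)
  let ?R = "position_rel t k q ?r \<pi>"
  have girthR: "girth_at_least {1..t} ?R g"
  \<comment> \<open>By the choice of \<open>\<pi>\<close>, \<open>\<beta>\<close> turns steps of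
    \<open>?R i\<close> into steps of \<open>S i\<close>.\<close>
  proof (rule girth_at_least_map[OF girth])
    fix i u v assume i: "i \<in> {1..t}" and uv: "(u, v) \<in> ?R i" "u \<noteq> v"
    obtain x x' where x: "u \<in> ?M" "v \<in> ?M" "(x, x') \<in> same_prefix t k q ?r"
      "level_pos t k q x = \<pi> i u" "level_pos t k q x' = \<pi> i v"
      using uv(1) unfolding position_rel_def by blast
    have \<beta>Y: "\<beta> u \<in> Y" "\<beta> v \<in> Y" using \<beta> x(1,2) by (auto dest: bij_betw_apply)
    have "y = F i (\<beta> w)" if "w \<in> ?M" "y \<in> ?L" "level_pos t k q y = \<pi> i w" for w y
    proof (rule inj_onD[OF bij_betw_imp_inj_on[OF posbij]])
      show "F i (\<beta> w) \<in> ?L"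
        using bij_betw_apply[OF F(1)[OF i] bij_betw_apply[OF \<beta> that(1)]] .
    qed (use that in \<open>simp_all add: \<pi>_def\<close>)
    then have "x = F i (\<beta> u)" "x' = F i (\<beta> v)" using x by (auto simp: same_prefix_def)
    then have "(\<beta> u, \<beta> v) \<in> S i" using F(2)[OF i \<beta>Y] x(3) by simp
    moreover have "\<beta> u \<noteq> \<beta> v" using bij_betw_imp_inj_on[OF \<beta>] x(1,2) uv(2) by (auto dest: inj_onD)
    ultimately show "(\<beta> u, \<beta> v) \<in> S i \<and> \<beta> u \<noteq> \<beta> v" ..
  qed
  \<comment> \<open>This makes the set of permutations have \<open>t\<close> elements. Equal
    permutations would give equal position relations, whose classes have at least 2 points, hence a
    closed walk of length 2.\<close>
  have "inj_on \<pi> {1..t}"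
  proof (rule inj_onI, rule ccontr)
    fix i i' assume i: "i \<in> {1..t}" "i' \<in> {1..t}" "\<pi> i = \<pi> i'" "i \<noteq> i'"
    have "card ?L \<noteq> 0" using card_level[OF q1] assms by (simp add: level_size_def)
    then obtain x where x: "x \<in> ?L" by fastforce
    have "\<not> same_prefix t k q ?r `` {x} \<subseteq> {x}"
      using cls[OF x] s card_mono[of "{x}" "same_prefix t k q ?r `` {x}"] by auto
    then obtain x' where x': "(x, x') \<in> same_prefix t k q ?r" "x' \<noteq> x" by blast
    have "x' \<in> ?L" using x' by (simp add: same_prefix_def)
    have img: "\<exists>u\<in>?M. level_pos t k q y = \<pi> i u" if "y \<in> ?L" for y
    proof -
      have "level_pos t k q y \<in> \<pi> i ` ?M"
        unfolding permutes_image[OF perm[OF i(1)]] by (rule bij_betw_apply[OF posbij that])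
      then show ?thesis by blast
    qed
    obtain u v where uv: "u \<in> ?M" "v \<in> ?M" "level_pos t k q x = \<pi> i u" "level_pos t k q x' = \<pi> i v"
      using img[OF x] img[OF \<open>x' \<in> ?L\<close>] by blast
    have "(x', x) \<in> same_prefix t k q ?r" using x'(1) by (simp add: same_prefix_def)
    with uv x'(1) have "(u, v) \<in> ?R i" "(v, u) \<in> ?R i'"
      unfolding position_rel_def i(3)[symmetric] by blast+
    then have "u = v" using girth_common_pair[OF girthR _ i(1,2,4)] assms by simp
    then have "level_pos t k q x = level_pos t k q x'" using uv by simp
    then show False
      using x x'(2) \<open>x' \<in> ?L\<close> bij_betw_imp_inj_on[OF posbij] by (auto dest: inj_onD)
  qed
  moreover have "\<not> has_cycle_of_length (glued_graph t k q \<pi>) h" if "k < h" "h < g" for h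
    using glued_graph_long_cycle[OF q1 perm assms(1) q that girthR] by blast
  moreover have "q \<ge> 2" using q assms by simp
  ultimately show ?thesis using perm by blast
qed

end
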